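(* Let $M$ be $\mathbb{N}$ or $\mathbb{Z}$, let $k$ be a field of characteristic zero, and let $k_0 \subset k$ be a computable subfield. Then the following problems are undecidable: (P1) Given $f_1, \ldots, f_{\ell}, g \in k_0[\sigma^m(\mathbf{X}) \mid m \in M]$, where $\mathbf{X} = (X_1, \ldots, X_n)$, determine whether the system $f_1 = \ldots = f_\ell = 0,\ g \neq 0$ has a solution in $k^{M}$ (i.e. whether there is $\mathbf{x}\in(k^M)^n$ with $f_1(\mathbf{x})=\ldots=f_\ell(\mathbf{x})=0$ and $g(\mathbf{x})\neq 0$ as elements of $k^M$). (P2) Given $f_1, \ldots, f_{\ell}, g \in k_0[\sigma^m(\mathbf{X}) \mid m \in M]$, where $\mathbf{X} = (X_1, \ldots, X_n)$, determine whether $$g \in \sqrt{ \langle \sigma^m(f_1), \ldots, \sigma^m(f_\ell) \mid m \in M \rangle }.$$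
   Context: $\mathbb{N}$ is the set of nonnegative integers; $\mathbb{N}$ and $\mathbb{Z}$ are monoids under addition. For $M=\mathbb{N}$ or $\mathbb{Z}$, the ring $k^M$ of sequences has componentwise operations and $M$-action $\sigma^m((x_i)_{i\in M})=(x_{i+m})_{i\in M}$; $k$ embeds as the constant sequences. The ring $k_0[\sigma^m(\mathbf{X}) \mid m \in M]$ is the polynomial ring over $k_0$ in the indeterminates $\sigma^m(X_i)$ ($m\in M$, $1\le i\le n$), with $M$ acting trivially on $k_0$ and by $\sigma^{m_1}(\sigma^{m_2}(X_i))=\sigma^{m_1+m_2}(X_i)$. For $\mathbf{x}\in(k^M)^n$, $f(\mathbf{x})\in k^M$ is the image of $f$ under the unique $k_0$-algebra morphism to $k^M$ commuting with the $M$-action and sending $X_i\mapsto x_i$. $\langle\cdot\rangle$ denotes the generated ideal in $k_0[\sigma^m(\mathbf{X}) \mid m \in M]$ and $\sqrt{\cdot}$ the radical. "Undecidable" means that no algorithm solves the problem. *)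

theory Defs
  imports
    "HOL-Library.Poly_Mapping"
    "HOL-Library.FuncSet"
    "HOL-Library.Nat_Bijection"
    "HOL-Algebra.Ideal"
    "HOL-Algebra.Subrings"
    "HOL-Algebra.Algebraic_Closure_Type"
begin

section \<open>Algorithms and decision problems\<close>

text \<open>Algorithms are partial recursive functions in the sense of Kleene. Arities are not part of
  the syntax: a program that is applied to a list of arguments of the wrong length, like one whose
  computation diverges, is related to no value (constants accept every argument list).\<close>

datatype recf =
    Zero
  | Succ
  | Proj nat
  | Comp recf "recf list"
  | PrimRec recf recf
  | Mu recf

inductive computes :: "recf \<Rightarrow> nat list \<Rightarrow> nat \<Rightarrow> bool" where
  Zero: "computes Zero xs 0"
| Succ: "computes Succ [x] (Suc x)"
| Proj: "i < length xs \<Longrightarrow> computes (Proj i) xs (xs ! i)"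
| Comp: "list_all2 (\<lambda>q y. computes q xs y) qs ys \<Longrightarrow> computes p ys z \<Longrightarrow> computes (Comp p qs) xs z"
| PrimRec_0: "computes p xs y \<Longrightarrow> computes (PrimRec p q) (0 # xs) y"
| PrimRec_Suc: "computes (PrimRec p q) (n # xs) y \<Longrightarrow> computes q (y # n # xs) z
    \<Longrightarrow> computes (PrimRec p q) (Suc n # xs) z"
| Mu: "computes p (n # xs) 0 \<Longrightarrow> (\<And>m. m < n \<Longrightarrow> \<exists>y. computes p (m # xs) (Suc y))
    \<Longrightarrow> computes (Mu p) xs n"

inductive_cases computes_cases:
  "computes Zero xs y" "computes Succ xs y" "computes (Proj i) xs y" "computes (Comp p qs) xs y"
  "computes (PrimRec p q) (0 # xs) y" "computes (PrimRec p q) (Suc n # xs) y"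
  "computes (Mu p) xs y"

lemma computes_functional: "computes p xs y \<Longrightarrow> computes p xs z \<Longrightarrow> y = z"
proof (induction arbitrary: z rule: computes.induct)
  case (Zero xs)
  then show ?case by (rule computes_cases) simp
next
  case (Succ x)
  then show ?case by (rule computes_cases) simp
next
  case (Proj i xs)
  from Proj.prems show ?case by (rule computes_cases) simp
next
  case (Comp xs qs ys p w)
  from Comp.prems obtain ys' where
    ys': "list_all2 (\<lambda>q y. computes q xs y) qs ys'" "computes p ys' z"
    by (rule computes_cases)
  have "ys = ys'"
    using Comp.IH(1) ys'(1) by (auto simp: list_all2_conv_all_nth intro!: nth_equalityI)
  with Comp.IH(2) ys'(2) show ?case by simp
next
  case (PrimRec_0 p xs y q)
  from PrimRec_0.prems have "computes p xs z" by (rule computes_cases)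
  then show ?case by (rule PrimRec_0.IH)
next
  case (PrimRec_Suc p q n xs y w)
  from PrimRec_Suc.prems obtain y' where
    "computes (PrimRec p q) (n # xs) y'" "computes q (y' # n # xs) z"
    by (rule computes_cases)
  with PrimRec_Suc.IH show ?case by metis
next
  case (Mu p n xs)
  from Mu.prems have z: "computes p (z # xs) 0" "\<And>m. m < z \<Longrightarrow> \<exists>y. computes p (m # xs) (Suc y)"
    by (auto elim!: computes_cases(7))
  show ?case
  proof (cases n z rule: linorder_cases)
    case less
    with z(2) obtain y where "computes p (n # xs) (Suc y)" by blast
    with Mu.IH(1) have "0 = Suc y" by blast
    then show ?thesis by simp
  next
    case greater
    with Mu.IH(2) obtain y where "\<And>v. computes p (z # xs) v \<Longrightarrow> Suc y = v" by blast
    with z(1) have "Suc y = 0" by blast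
    then show ?thesis by simp
  qed
qed

text \<open>The instances in \<open>D\<close> are presented to the algorithm by their code numbers. Nothing is required
  of the algorithm on numbers that do not code an instance.\<close>

definition decidable :: "('i \<Rightarrow> nat) \<Rightarrow> 'i set \<Rightarrow> ('i \<Rightarrow> bool) \<Rightarrow> bool" where
  "decidable code D Q \<longleftrightarrow> (\<exists>p. \<forall>i\<in>D. computes p [code i] (if Q i then 1 else 0))"

text \<open>A computable presentation of a field: its elements are coded by the numbers of a decidable set,
  and the operations are computable on codes. Negatives and inverses are then computable by search.\<close>

definition computable_presentation :: "'k::field set \<Rightarrow> ('k \<Rightarrow> nat) \<Rightarrow> bool" where
  "computable_presentation K code \<longleftrightarrow>
     inj_on code K \<and>
     decidable id UNIV (\<lambda>c. c \<in> code ` K) \<and>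
     (\<exists>p. \<forall>a\<in>K. \<forall>b\<in>K. computes p [code a, code b] (code (a + b))) \<and>
     (\<exists>p. \<forall>a\<in>K. \<forall>b\<in>K. computes p [code a, code b] (code (a * b)))"


section \<open>Polynomials\<close>

type_synonym ('v, 'a) mpoly = "('v \<Rightarrow>\<^sub>0 nat) \<Rightarrow>\<^sub>0 'a"

definition Const :: "'a::zero \<Rightarrow> ('v, 'a) mpoly" where
  "Const a = Poly_Mapping.single 0 a"

definition Var :: "'v \<Rightarrow> ('v, 'a::zero_neq_one) mpoly" where
  "Var v = Poly_Mapping.single (Poly_Mapping.single v 1) 1"

text \<open>The algebra morphism with \<open>Var v \<mapsto> r v\<close>; \<open>h\<close> embeds the coefficients into the target.\<close>

definition eval_mpoly :: "('a::zero \<Rightarrow> 'b::comm_semiring_1) \<Rightarrow> ('v \<Rightarrow> 'b) \<Rightarrow> ('v, 'a) mpoly \<Rightarrow> 'b" where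
  "eval_mpoly h r p =
     (\<Sum>t\<in>Poly_Mapping.keys p. h (Poly_Mapping.lookup p t) *
        (\<Prod>v\<in>Poly_Mapping.keys t. r v ^ Poly_Mapping.lookup t v))"

lemma eval_mpoly_Const: "h 0 = 0 \<Longrightarrow> eval_mpoly h r (Const a) = h a"
  by (cases "a = 0") (auto simp: eval_mpoly_def Const_def)

lemma eval_mpoly_Var: "h 1 = 1 \<Longrightarrow> eval_mpoly h r (Var v) = r v"
  by (simp add: eval_mpoly_def Var_def)

lemma eval_mpoly_add:
  assumes "h 0 = 0" "\<And>a b. h (a + b) = h a + h b"
  shows "eval_mpoly h r (p + q) = eval_mpoly h r p + eval_mpoly h r q"
  unfolding eval_mpoly_def
  by (rule setsum_keys_plus_distrib) (simp_all add: assms distrib_right)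

lemma eval_mpoly_sum:
  assumes "h 0 = 0" "\<And>a b. h (a + b) = h a + h b"
  shows "eval_mpoly h r (sum f A) = (\<Sum>a\<in>A. eval_mpoly h r (f a))"
proof -
  have "eval_mpoly h r 0 = 0" by (simp add: eval_mpoly_def)
  then show ?thesis
    by (induction A rule: infinite_finite_induct) (simp_all add: eval_mpoly_add assms)
qed

lemma mpoly_sum_singles:
  "p = (\<Sum>t\<in>Poly_Mapping.keys p. Poly_Mapping.single t (Poly_Mapping.lookup p t))"
  by (rule poly_mapping_eqI)
    (simp add: lookup_sum lookup_single when_def in_keys_iff sum.delta)

lemma eval_mpoly_mult:
  fixes h :: "'a::comm_semiring_1 \<Rightarrow> 'b::comm_semiring_1"
  assumes h: "h 0 = 0" "\<And>a b. h (a + b) = h a + h b" "\<And>a b. h (a * b) = h a * h b"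
  shows "eval_mpoly h r (p * q) = eval_mpoly h r p * eval_mpoly h r q"
proof -
  define m where "m t = (\<Prod>v\<in>Poly_Mapping.keys t. r v ^ Poly_Mapping.lookup t v)" for t
  have m_sup: "m t = (\<Prod>v\<in>S. r v ^ Poly_Mapping.lookup t v)"
    if "Poly_Mapping.keys t \<subseteq> S" "finite S" for S t
    unfolding m_def using that by (intro prod.mono_neutral_left) (auto simp: in_keys_iff)
  have m_add: "m (s + t) = m s * m t" for s t
  proof -
    let ?S = "Poly_Mapping.keys s \<union> Poly_Mapping.keys t"
    have "Poly_Mapping.keys (s + t) \<subseteq> ?S" by (rule keys_add)
    then show ?thesis
      by (simp add: m_sup[of _ ?S] lookup_add power_add prod.distrib)
  qed
  have single: "eval_mpoly h r (Poly_Mapping.single t a) = h a * m t" for t a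
    by (cases "a = 0") (simp_all add: eval_mpoly_def m_def h)
  let ?P = "\<lambda>t. Poly_Mapping.single t (Poly_Mapping.lookup p t)"
  let ?Q = "\<lambda>t. Poly_Mapping.single t (Poly_Mapping.lookup q t)"
  have "p * q = (\<Sum>s\<in>Poly_Mapping.keys p. \<Sum>t\<in>Poly_Mapping.keys q. ?P s * ?Q t)"
    by (subst mpoly_sum_singles[of p], subst mpoly_sum_singles[of q]) (rule sum_product)
  then have "eval_mpoly h r (p * q) = (\<Sum>s\<in>Poly_Mapping.keys p. \<Sum>t\<in>Poly_Mapping.keys q.
      (h (Poly_Mapping.lookup p s) * m s) * (h (Poly_Mapping.lookup q t) * m t))"
    by (simp add: eval_mpoly_sum h mult_single single m_add mult_ac)
  also have "\<dots> = eval_mpoly h r p * eval_mpoly h r q"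
    by (simp add: eval_mpoly_def m_def sum_product)
  finally show ?thesis .
qed


lemma eval_mpoly_eval_mpoly_Const:
  fixes p :: "('v, 'a::comm_semiring_1) mpoly" and s :: "'v \<Rightarrow> ('w, 'a) mpoly"
  shows "eval_mpoly (\<lambda>a. a) r (eval_mpoly Const s p) = eval_mpoly (\<lambda>a. a) (\<lambda>v. eval_mpoly (\<lambda>a. a) r (s v)) p"
proof -
  have mult: "eval_mpoly (\<lambda>a. a) r (a * b) = eval_mpoly (\<lambda>a. a) r a * eval_mpoly (\<lambda>a. a) r b" for a b :: "('w, 'a) mpoly"
    by (simp add: eval_mpoly_mult)
  have one: "eval_mpoly (\<lambda>a. a) r (1 :: ('w, 'a) mpoly) = 1"
    by (simp add: eval_mpoly_def)
  have power: "eval_mpoly (\<lambda>a. a) r (a ^ d) = eval_mpoly (\<lambda>a. a) r a ^ d" for a :: "('w, 'a) mpoly" and d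
    by (induction d) (simp_all add: mult one)
  have prod: "eval_mpoly (\<lambda>a. a) r (prod f A) = (\<Prod>a\<in>A. eval_mpoly (\<lambda>a. a) r (f a))"
    for f :: "'v \<Rightarrow> ('w, 'a) mpoly" and A
    by (induction A rule: infinite_finite_induct) (simp_all add: mult one)
  show ?thesis
    unfolding eval_mpoly_def[of Const] eval_mpoly_def[of "\<lambda>a. a" _ p]
    by (simp add: eval_mpoly_sum mult eval_mpoly_Const prod power)
qed


section \<open>Difference polynomials and sequences\<close>

text \<open>\<open>M \<in> {\<nat>, \<int>}\<close> is a set of integers. The indeterminate \<open>\<sigma>\<^sup>m(X\<^sub>i)\<close> is \<open>Var (i, m)\<close>.\<close>

type_synonym 'k dpoly = "(nat \<times> int, 'k) mpoly"

definition dpoly_ring :: "'k::field set \<Rightarrow> nat \<Rightarrow> int set \<Rightarrow> 'k dpoly ring" where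
  "dpoly_ring K n M = (ring_of_type_algebra :: 'k dpoly ring)
     \<lparr>carrier := {f. \<forall>t\<in>Poly_Mapping.keys f.
        Poly_Mapping.lookup f t \<in> K \<and> Poly_Mapping.keys t \<subseteq> {1..n} \<times> M}\<rparr>"

lemma cring_dpoly_ring:
  assumes "subfield K (ring_of_type_algebra :: 'k::field ring)"
  shows "cring (dpoly_ring K n M)"
proof -
  let ?R = "ring_of_type_algebra :: 'k ring" and ?P = "ring_of_type_algebra :: 'k dpoly ring"
  interpret R: cring ?R by (rule cring_from_type_algebra)
  interpret P: cring ?P by (rule cring_from_type_algebra)
  interpret K: subfield K ?R by (rule assms)
  have R_simps: "\<zero>\<^bsub>?R\<^esub> = 0" "\<one>\<^bsub>?R\<^esub> = 1" "\<And>a b. a \<oplus>\<^bsub>?R\<^esub> b = a + b" "\<And>a b. a \<otimes>\<^bsub>?R\<^esub> b = a * b"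
    by (simp_all add: ring_of_type_algebra_def)
  have P_simps: "\<one>\<^bsub>?P\<^esub> = 1" "\<And>a b. a \<oplus>\<^bsub>?P\<^esub> b = a + b" "\<And>a b. a \<otimes>\<^bsub>?P\<^esub> b = a * b"
    "carrier ?P = UNIV" "\<zero>\<^bsub>?P\<^esub> = 0"
    by (simp_all add: ring_of_type_algebra_def)
  have K0: "0 \<in> K" and K1: "1 \<in> K"
    using subringE(2,3)[OF K.subring_axioms] by (simp_all add: R_simps)
  have K_add: "a + b \<in> K" and K_mult: "a * b \<in> K" if "a \<in> K" "b \<in> K" for a b
    using that subringE(6,7)[OF K.subring_axioms, of a b] by (simp_all add: R_simps)
  have K_minus: "- a \<in> K" if "a \<in> K" for a
  proof -
    have "\<ominus>\<^bsub>?R\<^esub> a = - a"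
      by (rule R.minus_equality) (simp_all add: ring_of_type_algebra_def)
    with subringE(5)[OF K.subring_axioms that] show ?thesis by simp
  qed
  define C where "C = {f :: 'k dpoly. \<forall>t\<in>Poly_Mapping.keys f.
    Poly_Mapping.lookup f t \<in> K \<and> Poly_Mapping.keys t \<subseteq> {1..n} \<times> M}"
  have K_lookup: "Poly_Mapping.lookup f t \<in> K" if "f \<in> C" for f t
    using that K0 by (cases "t \<in> Poly_Mapping.keys f") (auto simp: C_def in_keys_iff)
  have "subring C ?P"
  proof (rule P.subringI)
    fix f g assume f: "f \<in> C" and g: "g \<in> C"
    have "Poly_Mapping.keys t \<subseteq> {1..n} \<times> M" if "t \<in> Poly_Mapping.keys (f + g)" for t
      using subsetD[OF keys_add that] f g unfolding C_def by blast
    moreover have "Poly_Mapping.lookup (f + g) t \<in> K" for t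
      unfolding lookup_add by (intro K_add K_lookup f g)
    ultimately show "f \<oplus>\<^bsub>?P\<^esub> g \<in> C"
      unfolding P_simps C_def by blast
    have "Poly_Mapping.lookup (f * g) t \<in> K" for t
    proof -
      have "Poly_Mapping.lookup (f * g) t = (\<Sum>a\<in>Poly_Mapping.keys f. \<Sum>b\<in>Poly_Mapping.keys g.
          Poly_Mapping.lookup f a * Poly_Mapping.lookup g b when a + b = t)"
        by (subst mpoly_sum_singles[of f], subst mpoly_sum_singles[of g])
          (simp add: sum_product lookup_sum mult_single lookup_single)
      moreover have K_sum: "sum h A \<in> K" if "\<And>a. a \<in> A \<Longrightarrow> h a \<in> K"
        for A and h :: "(nat \<times> int \<Rightarrow>\<^sub>0 nat) \<Rightarrow> 'k"
        using that by (induction A rule: infinite_finite_induct) (auto simp: K0 K_add)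
      moreover have "(Poly_Mapping.lookup f a * Poly_Mapping.lookup g b when a + b = t) \<in> K" for a b
        by (simp add: when_def K0 K_mult K_lookup f g)
      ultimately show ?thesis by (simp only: K_sum)
    qed
    moreover have "Poly_Mapping.keys t \<subseteq> {1..n} \<times> M" if t: "t \<in> Poly_Mapping.keys (f * g)" for t
    proof -
      obtain a b where "t = a + b" "a \<in> Poly_Mapping.keys f" "b \<in> Poly_Mapping.keys g"
        using t keys_mult[of f g] by blast
      moreover from this f g have
        "Poly_Mapping.keys a \<union> Poly_Mapping.keys b \<subseteq> {1..n} \<times> M"
        unfolding C_def by blast
      ultimately show ?thesis using keys_add[of a b] by blast
    qed
    ultimately show "f \<otimes>\<^bsub>?P\<^esub> g \<in> C" unfolding P_simps C_def by blast
  next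
    fix f assume f: "f \<in> C"
    have "\<ominus>\<^bsub>?P\<^esub> f = - f"
      by (rule P.minus_equality) (simp_all add: ring_of_type_algebra_def)
    moreover have "- f \<in> C"
      using f K_minus by (auto simp: C_def in_keys_iff)
    ultimately show "\<ominus>\<^bsub>?P\<^esub> f \<in> C" by simp
  qed (simp_all add: P_simps C_def K1)
  then have "cring (?P\<lparr>carrier := C\<rparr>)"
    using P.subcringI' P.subcring_iff[of C] by (simp add: P_simps)
  then show ?thesis unfolding dpoly_ring_def C_def .
qed

definition dpoly_shift :: "int \<Rightarrow> 'k::field dpoly \<Rightarrow> 'k dpoly" where
  "dpoly_shift m = eval_mpoly Const (\<lambda>(i, j). Var (i, m + j))"

definition seq_shift :: "int set \<Rightarrow> int \<Rightarrow> (int \<Rightarrow> 'k) \<Rightarrow> int \<Rightarrow> 'k" where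
  "seq_shift M m x = (\<lambda>j\<in>M. x (j + m))"

text \<open>Sequences are elements of \<open>M \<rightarrow>\<^sub>E UNIV\<close>. Since the operations on sequences are componentwise,
  \<open>f(x)\<close> is computed componentwise.\<close>

definition dpoly_apply :: "int set \<Rightarrow> 'k::field dpoly \<Rightarrow> (nat \<Rightarrow> int \<Rightarrow> 'k) \<Rightarrow> int \<Rightarrow> 'k" where
  "dpoly_apply M f x = (\<lambda>j\<in>M. eval_mpoly (\<lambda>a. a) (\<lambda>(i, m). seq_shift M m (x i) j) f)"

lemma dpoly_apply_shift:
  assumes "\<And>i j. i \<in> M \<Longrightarrow> j \<in> M \<Longrightarrow> i + j \<in> M" and "m \<in> M"
  shows "dpoly_apply M (dpoly_shift m f) x = seq_shift M m (dpoly_apply M f x)"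
proof
  fix j
  have "eval_mpoly (\<lambda>a. a) (\<lambda>v. eval_mpoly (\<lambda>a. a) (\<lambda>(i, m). seq_shift M m (x i) j) (case v of (i, l) \<Rightarrow> Var (i, m + l))) f
      = eval_mpoly (\<lambda>a. a) (\<lambda>(i, l). seq_shift M l (x i) (j + m)) f" if "j \<in> M"
    using that assms
    by (intro arg_cong[where f = "\<lambda>r. eval_mpoly (\<lambda>a. a) r f"])
      (auto simp: fun_eq_iff eval_mpoly_Var seq_shift_def add_ac)
  then show "dpoly_apply M (dpoly_shift m f) x j = seq_shift M m (dpoly_apply M f x) j"
    using assms
    by (auto simp: dpoly_apply_def dpoly_shift_def seq_shift_def eval_mpoly_eval_mpoly_Const)
qed

definition zero_seq :: "int set \<Rightarrow> int \<Rightarrow> 'k::zero" where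
  "zero_seq M = (\<lambda>j\<in>M. 0)"

definition solvable_in_seqs :: "int set \<Rightarrow> nat \<Rightarrow> 'k::field dpoly set \<Rightarrow> 'k dpoly \<Rightarrow> bool" where
  "solvable_in_seqs M n F g \<longleftrightarrow>
     (\<exists>x \<in> {1..n} \<rightarrow>\<^sub>E (M \<rightarrow>\<^sub>E UNIV).
        (\<forall>f\<in>F. dpoly_apply M f x = zero_seq M) \<and> dpoly_apply M g x \<noteq> zero_seq M)"

definition radical :: "('a, 'b) ring_scheme \<Rightarrow> 'a set \<Rightarrow> 'a set" where
  "radical R I = {a \<in> carrier R. \<exists>e::nat. a [^]\<^bsub>R\<^esub> e \<in> I}"

definition in_radical_diff_ideal ::
  "'k::field set \<Rightarrow> int set \<Rightarrow> nat \<Rightarrow> 'k dpoly set \<Rightarrow> 'k dpoly \<Rightarrow> bool" where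
  "in_radical_diff_ideal K M n F g \<longleftrightarrow>
     g \<in> radical (dpoly_ring K n M)
           (Idl\<^bsub>dpoly_ring K n M\<^esub> {dpoly_shift m f | m f. m \<in> M \<and> f \<in> F})"


section \<open>Finite descriptions of the input\<close>

text \<open>A polynomial is given as a list of terms, a term as a coefficient and a list of pairs of an
  indeterminate and an exponent. Repetitions are allowed.\<close>

type_synonym 'k dpoly_expr = "('k \<times> ((nat \<times> int) \<times> nat) list) list"

definition dpoly_of :: "'k::field dpoly_expr \<Rightarrow> 'k dpoly" where
  "dpoly_of ts = (\<Sum>(a, ps)\<leftarrow>ts. Const a * (\<Prod>(v, d)\<leftarrow>ps. Var v ^ d))"

definition dpoly_exprs :: "'k set \<Rightarrow> nat \<Rightarrow> int set \<Rightarrow> 'k dpoly_expr set" where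
  "dpoly_exprs K n M = lists (K \<times> lists (({1..n} \<times> M) \<times> UNIV))"

lemma dpoly_of_surj:
  assumes "f \<in> carrier (dpoly_ring K n M)"
  shows "f \<in> dpoly_of ` dpoly_exprs K n M"
proof -
  obtain ts where ts: "distinct ts" "set ts = Poly_Mapping.keys f"
    using finite_distinct_list[OF finite_keys] by metis
  define vs :: "(nat \<times> int \<Rightarrow>\<^sub>0 nat) \<Rightarrow> (nat \<times> int) list"
    where "vs t = (SOME l. distinct l \<and> set l = Poly_Mapping.keys t)" for t
  have vs: "distinct (vs t)" "set (vs t) = Poly_Mapping.keys t" for t
    using someI_ex[OF finite_distinct_list[OF finite_keys[of t]], folded vs_def]
    unfolding vs_def by (metis (mono_tags, lifting) finite_distinct_list finite_keys someI_ex)+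
  define e where "e = map (\<lambda>t. (Poly_Mapping.lookup f t,
    map (\<lambda>v. (v, Poly_Mapping.lookup t v)) (vs t))) ts"
  have var_power: "(Var v :: 'a dpoly) ^ d = Poly_Mapping.single (Poly_Mapping.single v d) 1" for v d
    by (induction d) (simp_all add: Var_def mult_single single_add[symmetric])
  have prod_single: "(\<Prod>v\<in>A. Poly_Mapping.single (h v) (1::'a)) = Poly_Mapping.single (sum h A) 1"
    for A :: "(nat \<times> int) set" and h :: "_ \<Rightarrow> nat \<times> int \<Rightarrow>\<^sub>0 nat"
    by (induction A rule: infinite_finite_induct) (simp_all add: mult_single)
  have "(\<Prod>(v, d)\<leftarrow>map (\<lambda>v. (v, Poly_Mapping.lookup t v)) (vs t). (Var v :: 'a dpoly) ^ d)
      = Poly_Mapping.single t 1" for t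
    using prod.distinct_set_conv_list[OF vs(1)[of t], of "\<lambda>v. (Var v :: 'a dpoly) ^ Poly_Mapping.lookup t v"]
    by (simp add: o_def vs(2) var_power prod_single flip: mpoly_sum_singles[of t])
  then have "dpoly_of e = (\<Sum>t\<leftarrow>ts. Poly_Mapping.single t (Poly_Mapping.lookup f t))"
    by (simp add: dpoly_of_def e_def o_def Const_def mult_single)
  also have "\<dots> = f"
    using sum.distinct_set_conv_list[OF ts(1), of "\<lambda>t. Poly_Mapping.single t (Poly_Mapping.lookup f t)"]
    by (simp add: ts(2) mpoly_sum_singles[of f, symmetric])
  finally have "dpoly_of e = f" .
  moreover have "e \<in> dpoly_exprs K n M"
    using assms ts vs by (fastforce simp: e_def dpoly_exprs_def dpoly_ring_def)
  ultimately show ?thesis by blast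
qed

definition encode_expr :: "('k \<Rightarrow> nat) \<Rightarrow> 'k dpoly_expr \<Rightarrow> nat" where
  "encode_expr code ts = list_encode (map (\<lambda>(a, ps). prod_encode (code a,
     list_encode (map (\<lambda>((i, m), d). prod_encode (prod_encode (i, int_encode m), d)) ps))) ts)"

text \<open>An instance \<open>(n, [f\<^sub>1, \<dots>, f\<^sub>l], g)\<close>; both \<open>n\<close> and \<open>l\<close> are part of the input.\<close>

type_synonym 'k system = "nat \<times> 'k dpoly_expr list \<times> 'k dpoly_expr"

definition systems :: "'k set \<Rightarrow> int set \<Rightarrow> 'k system set" where
  "systems K M = {(n, fs, g). n \<ge> 1 \<and> fs \<noteq> [] \<and> set fs \<subseteq> dpoly_exprs K n M \<and> g \<in> dpoly_exprs K n M}"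

definition encode_system :: "('k \<Rightarrow> nat) \<Rightarrow> 'k system \<Rightarrow> nat" where
  "encode_system code = (\<lambda>(n, fs, g).
     prod_encode (n, prod_encode (list_encode (map (encode_expr code) fs), encode_expr code g)))"

end

theory Submission
  imports Defs
begin

text \<open>A program \<open>q\<close> is translated into a structured program over registers, and the run of the latter into
  a difference system: a sequence for each register and, for each of the finitely many control points,
  a sequence that indicates when control is there. A test for equality in the field is expressed by
  an equation with an auxiliary inverse. A further sequence \<open>v\<close> forces the initial configuration wherever it is
  nonzero, and no solution may reach the final control point. If \<open>q\<close> diverges on the input, its run, preceded by zeros
  when \<open>M = \<int>\<close>, is a solution with \<open>v \<noteq> 0\<close>. If \<open>q\<close> halts, then following its run modulo the ideal quotient
  by \<open>v\<close> shows that this quotient contains \<open>1\<close>, so \<open>v\<close> lies in the difference ideal. Thus both problems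
  decide the convergence of \<open>q\<close>.

  No universal machine is needed for the diagonal argument. The input \<open>y\<close> enters the system through
  a single equation, so the map from a pair of a number \<open>y\<close> and a code of a list of equations to the
  code of the list extended by the input equation is computable. For \<open>q\<close> the program that runs a
  supposed decision procedure on the image of \<open>(y, y)\<close>, take \<open>y\<close> to be the code of the equations of \<open>q\<close> itself.\<close>

section \<open>Computable functions and diagonalization\<close>

definition total_computable :: "(nat \<Rightarrow> nat) \<Rightarrow> bool" where
  "total_computable f \<longleftrightarrow> (\<exists>p. \<forall>x. computes p [x] (f x))"

lemma computes_Comp1:
  "computes q xs y \<Longrightarrow> computes p [y] z \<Longrightarrow> computes (Comp p [q]) xs z"
  by (rule computes.Comp[of _ _ "[y]"]) auto

lemma computes_Comp2:
  "computes q xs y \<Longrightarrow> computes q' xs y' \<Longrightarrow> computes p [y, y'] z \<Longrightarrow> computes (Comp p [q, q']) xs z"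
  by (rule computes.Comp[of _ _ "[y, y']"]) auto

lemma computes_Proj_0: "computes (Proj 0) (x # xs) x"
  using computes.Proj[of 0 "x # xs"] by simp

lemma computes_Proj_1: "computes (Proj 1) (x # y # xs) y"
  using computes.Proj[of 1 "x # y # xs"] by simp

lemma ex_computes_const: "\<exists>p. \<forall>xs. computes p xs c"
proof (induction c)
  case 0
  show ?case by (blast intro: computes.Zero)
next
  case (Suc c)
  then show ?case by (blast intro: computes_Comp1 computes.Succ)
qed

lemma ex_computes_add: "\<exists>p. \<forall>x y. computes p [x, y] (x + y)"
proof (intro exI allI)
  fix x y
  show "computes (PrimRec (Proj 0) (Comp Succ [Proj 0])) [x, y] (x + y)"
  proof (induction x)
    case 0
    show ?case using computes.PrimRec_0[OF computes_Proj_0] by simp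
  next
    case (Suc x)
    show ?case
      using computes.PrimRec_Suc[OF Suc computes_Comp1[OF computes_Proj_0 computes.Succ]] by simp
  qed
qed

text \<open>The Cantor pairing is \<open>triangle (x + y) + x\<close>, and the triangular numbers
  satisfy a primitive recursion. In the recursion step \<open>Proj 0\<close> is the previous value
  and \<open>Proj 1\<close> the index.\<close>

lemma ex_computes_prod_encode: "\<exists>p. \<forall>x y. computes p [x, y] (prod_encode (x, y))"
proof -
  obtain add where add: "\<And>x y. computes add [x, y] (x + y)" using ex_computes_add by blast
  define tri where "tri = PrimRec Zero (Comp add [Proj 0, Comp Succ [Proj 1]])"
  have tri: "computes tri [x] (triangle x)" for x
  proof (induction x)
    case 0
    show ?case unfolding tri_def using computes.PrimRec_0[OF computes.Zero] by simp
  next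
    case (Suc x)
    show ?case unfolding tri_def triangle_Suc
      by (rule computes.PrimRec_Suc[OF Suc[unfolded tri_def]])
        (intro computes_Comp2[OF computes_Proj_0 _ add] computes_Comp1[OF computes_Proj_1] computes.Succ)
  qed
  have "computes (Comp add [Comp tri [add], Proj 0]) [x, y] (prod_encode (x, y))" for x y
    unfolding prod_encode_def by (auto intro!: computes_Comp2[OF _ _ add] computes_Comp1[OF add tri] computes_Proj_0)
  then show ?thesis by blast
qed

lemma total_computable_const: "total_computable (\<lambda>x. c)"
  unfolding total_computable_def using ex_computes_const[of c] by blast

lemma total_computable_id: "total_computable (\<lambda>x. x)"
  unfolding total_computable_def by (blast intro: computes_Proj_0)

lemma total_computable_Suc: "total_computable f \<Longrightarrow> total_computable (\<lambda>x. Suc (f x))"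
  unfolding total_computable_def by (blast intro: computes_Comp1 computes.Succ)

lemma total_computable_prod_encode:
  assumes "total_computable f" "total_computable g"
  shows "total_computable (\<lambda>x. prod_encode (f x, g x))"
  using assms ex_computes_prod_encode unfolding total_computable_def
  by (blast intro: computes_Comp2)

text \<open>The number is reached from \<open>code 0\<close> by repeatedly adding \<open>1\<close>
  with the addition program of the presentation. This makes the code of the input equation
  computable, where the input occurs as a coefficient.\<close>

lemma total_computable_code_of_nat:
  fixes code :: "'k::field \<Rightarrow> nat"
  assumes "computable_presentation K code" and K: "\<And>i. of_nat i \<in> K"
  shows "total_computable (\<lambda>x. code (of_nat x))"
proof -
  obtain p where p: "\<And>a b. a \<in> K \<Longrightarrow> b \<in> K \<Longrightarrow> computes p [code a, code b] (code (a + b))"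
    using assms(1) unfolding computable_presentation_def by blast
  obtain c0 where c0: "\<And>xs. computes c0 xs (code 0)" using ex_computes_const by blast
  obtain c1 where c1: "\<And>xs. computes c1 xs (code 1)" using ex_computes_const by blast
  have "computes (PrimRec c0 (Comp p [c1, Proj 0])) [x] (code (of_nat x))" for x
  proof (induction x)
    case 0
    show ?case using computes.PrimRec_0[OF c0] by simp
  next
    case (Suc x)
    have "computes p [code 1, code (of_nat x)] (code (1 + of_nat x))"
      by (rule p) (use K[of 1] K[of x] in auto)
    then show ?case
      by (auto intro!: computes.PrimRec_Suc[OF Suc] computes_Comp2[OF c1 computes_Proj_0])
  qed
  then show ?thesis unfolding total_computable_def by blast
qed

lemma decidable_not:
  assumes "decidable code D Q"
  shows "decidable code D (\<lambda>i. \<not> Q i)"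
proof -
  obtain d where d: "\<And>i. i \<in> D \<Longrightarrow> computes d [code i] (if Q i then 1 else 0)"
    using assms unfolding decidable_def by blast
  obtain one where one: "\<And>xs. computes one xs 1" using ex_computes_const by blast
  \<comment> \<open>Primitive recursion with value 1 at zero and 0 at every successor swaps the two
    truth values.\<close>
  have neg: "computes (PrimRec one Zero) [if b then 1 else 0] (if \<not> b then 1 else 0)" for b
    using computes.PrimRec_0[OF one] computes.PrimRec_Suc[OF computes.PrimRec_0[OF one] computes.Zero]
    by simp
  have "computes (Comp (PrimRec one Zero) [d]) [code i] (if \<not> Q i then 1 else 0)" if "i \<in> D" for i
    by (rule computes_Comp1[OF d[OF that] neg])
  then show ?thesis unfolding decidable_def by blast
qed

text \<open>A problem to which the convergence of each program reduces is undecidable. The reduction need not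
  be uniform in the program: all that is asked for is one input \<open>y\<close>, which may depend on the program
  \<open>q\<close>, at which \<open>h\<close> gives the instance.\<close>

lemma undecidable_by_diagonalization:
  assumes h: "total_computable h"
    and red: "\<And>q. \<exists>y. \<exists>i\<in>D. code i = h y \<and> (Q i \<longleftrightarrow> (\<exists>z. computes q [y] z))"
  shows "\<not> decidable code D Q"
proof
  assume "decidable code D Q"
  then obtain d where d: "\<And>i. i \<in> D \<Longrightarrow> computes d [code i] (if Q i then 1 else 0)"
    unfolding decidable_def by blast
  obtain ph where ph: "\<And>x. computes ph [x] (h x)" using h unfolding total_computable_def by blast
  \<comment> \<open>The search variable is ignored: \<open>Mu p\<close> stops at once if the
    decision procedure answers 0 and searches forever if it answers 1.\<close>
  define p where "p = Comp d [Comp ph [Proj 1]]"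
  obtain y i where i: "i \<in> D" "code i = h y" "Q i \<longleftrightarrow> (\<exists>z. computes (Mu p) [y] z)"
    using red[of "Mu p"] by blast
  have p: "computes p [m, y] (if Q i then 1 else 0)" for m
    unfolding p_def using d[OF i(1), unfolded i(2)]
    by (rule computes_Comp1[OF computes_Comp1[OF computes_Proj_1 ph]])
  show False
  proof (cases "Q i")
    case True
    then obtain z where "computes (Mu p) [y] z" using i(3) by blast
    then have "computes p [z, y] 0" by (auto elim: computes_cases(7))
    with p[of z] True show False using computes_functional by fastforce
  next
    case False
    then have "computes (Mu p) [y] 0" using p[of 0] by (auto intro: computes.Mu)
    with False i(3) show False by blast
  qed
qed


section \<open>Structured register programs\<close>

text \<open>\<open>Asg r s c\<close> sets register \<open>r\<close> to the contents of
  \<open>s\<close> plus the constant \<open>c\<close>; \<open>While r s c\<close> repeats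
  \<open>c\<close> as long as registers \<open>r\<close> and \<open>s\<close> differ.\<close>

datatype com = Asg nat nat nat | Seq com com | While nat nat com

text \<open>Every control point performs one assignment and one equality test, so that the same few
  kinds of equations describe them all.\<close>

datatype instruction = Instr (dst: nat) (src: nat) (inc: nat) (lhs: nat) (rhs: nat)
  (on_eq: "com list") (on_neq: "com list")

text \<open>A control point is the stack of commands still to be executed. Where no assignment or no
  test is wanted, the trivial one on register 0 is inserted; the empty stack leads to
  itself.\<close>

fun instr :: "com list \<Rightarrow> instruction" where
  "instr [] = Instr 0 0 0 0 0 [] []"
| "instr (Asg r s c # k) = Instr r s c 0 0 k k"
| "instr (Seq c d # k) = Instr 0 0 0 0 0 (c # d # k) (c # d # k)"
| "instr (While r s c # k) = Instr 0 0 0 r s k (c # While r s c # k)"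

text \<open>Test and assignment both read the old contents, so one step relates only two consecutive
  times of the difference system.\<close>

fun step :: "com list \<times> (nat \<Rightarrow> nat) \<Rightarrow> com list \<times> (nat \<Rightarrow> nat)" where
  "step (l, s) = (if s (lhs (instr l)) = s (rhs (instr l)) then on_eq (instr l) else on_neq (instr l),
     s(dst (instr l) := s (src (instr l)) + inc (instr l)))"

section \<open>Reachability and divergence of configurations\<close>

definition reaches where "reaches x y \<longleftrightarrow> (\<exists>n. (step ^^ n) x = y)"

definition diverges where "diverges x \<longleftrightarrow> (\<forall>n. fst ((step ^^ n) x) \<noteq> [])"

lemma reaches_refl: "reaches x x"
  unfolding reaches_def by (rule exI[of _ 0]) simp

lemma reaches_trans: "reaches x y \<Longrightarrow> reaches y z \<Longrightarrow> reaches x z"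
  unfolding reaches_def by (auto simp flip: funpow_add[THEN fun_cong, unfolded comp_apply])

lemma reaches_step: "reaches (step x) y \<Longrightarrow> reaches x y"
  unfolding reaches_def using funpow_Suc_right[of _ step, THEN fun_cong, unfolded comp_apply] by metis

lemma halted_stable: "fst x = [] \<Longrightarrow> fst ((step ^^ n) x) = []"
proof (induction n)
  case (Suc n)
  then show ?case by (cases "(step ^^ n) x") simp
qed simp

text \<open>By determinism \<open>y\<close> lies on the run of \<open>x\<close>, so after
  \<open>n\<close> further steps it is at least as far along that run as \<open>x\<close> after
  \<open>n\<close> steps; an empty stack stays empty.\<close>

lemma halts_if_reaches:
  assumes "reaches x y" "fst ((step ^^ n) x) = []"
  shows "fst ((step ^^ n) y) = []"
proof -
  obtain m where "(step ^^ m) x = y" using assms unfolding reaches_def by blast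
  moreover have "(step ^^ (n + m)) x = (step ^^ (m + n)) x" by (simp add: add.commute)
  ultimately have "(step ^^ n) y = (step ^^ m) ((step ^^ n) x)" by (simp add: funpow_add)
  with halted_stable[OF assms(2)] show ?thesis by simp
qed

lemma diverges_if_reaches: "reaches x y \<Longrightarrow> diverges y \<Longrightarrow> diverges x"
  unfolding diverges_def using halts_if_reaches by blast

text \<open>At least one step is made before the invariant is required again, so induction on the
  length of the run prefix applies. The possible further steps up to \<open>y\<close> do no harm, by
  \<open>halts_if_reaches\<close>.\<close>

lemma diverges_coinduct:
  assumes "Inv x" and Inv: "\<And>x. Inv x \<Longrightarrow> fst x \<noteq> [] \<and> (diverges (step x) \<or> (\<exists>y. reaches (step x) y \<and> Inv y))"
  shows "diverges x"
proof -
  have "Inv x \<Longrightarrow> fst ((step ^^ n) x) \<noteq> []" for n x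
  proof (induction n arbitrary: x)
    case 0
    then show ?case using Inv by simp
  next
    case (Suc n)
    have eq: "(step ^^ Suc n) x = (step ^^ n) (step x)" by (simp add: funpow_Suc_right del: funpow.simps)
    show ?case using Inv[OF Suc.prems] Suc.IH halts_if_reaches unfolding eq diverges_def by blast
  qed
  with assms(1) show ?thesis unfolding diverges_def by blast
qed

section \<open>Terminating and looping commands\<close>

text \<open>Quantifying over the continuation \<open>k\<close> lets statements about a command be
  used inside any larger program.\<close>

definition runs where "runs c s s' \<longleftrightarrow> (\<forall>k. reaches (c # k, s) (k, s'))"
definition loops where "loops c s \<longleftrightarrow> (\<forall>k. diverges (c # k, s))"

lemma runs_Asg: "runs (Asg r s c) st (st(r := st s + c))"
  unfolding runs_def by (rule allI, rule reaches_step) (simp add: reaches_refl)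

lemma runs_Seq: "runs c s s' \<Longrightarrow> runs d s' s'' \<Longrightarrow> runs (Seq c d) s s''"
  unfolding runs_def by (rule allI, rule reaches_step) (auto intro: reaches_trans)

lemma diverges_step: "diverges (step x) \<Longrightarrow> diverges x"
  by (rule diverges_if_reaches[OF reaches_step[OF reaches_refl]])

lemma loops_Seq1: "loops c s \<Longrightarrow> loops (Seq c d) s"
  unfolding loops_def by (rule allI, rule diverges_step) simp

lemma loops_Seq2: "runs c s s' \<Longrightarrow> loops d s' \<Longrightarrow> loops (Seq c d) s"
  unfolding loops_def runs_def by (rule allI, rule diverges_step) (auto intro: diverges_if_reaches)

lemma runs_While_done: "s r = s t \<Longrightarrow> runs (While r t c) s s"
  unfolding runs_def by (rule allI, rule reaches_step) (simp add: reaches_refl)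

lemma runs_While_step:
  "s r \<noteq> s t \<Longrightarrow> runs c s s' \<Longrightarrow> runs (While r t c) s' s'' \<Longrightarrow> runs (While r t c) s s''"
  unfolding runs_def by (rule allI, rule reaches_step) (auto intro: reaches_trans)

text \<open>The invariant is needed only at the loop head: each pass either diverges inside the body
  or returns to the head.\<close>

lemma loops_While_coinduct:
  assumes "Inv s"
    and Inv: "\<And>s. Inv s \<Longrightarrow> s r \<noteq> s t \<and> (loops c s \<or> (\<exists>s'. runs c s s' \<and> Inv s'))"
  shows "loops (While r t c) s"
  unfolding loops_def
proof
  fix k
  show "diverges (While r t c # k, s)"
  proof (rule diverges_coinduct[where Inv = "\<lambda>x. \<exists>s. Inv s \<and> x = (While r t c # k, s)"])
    fix x assume "\<exists>s. Inv s \<and> x = (While r t c # k, s)"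
    then obtain s where s: "Inv s" and x: "x = (While r t c # k, s)" by blast
    then have "step x = (c # While r t c # k, s)" using Inv by auto
    moreover note Inv[OF s, unfolded loops_def runs_def]
    ultimately show "fst x \<noteq> [] \<and> (diverges (step x) \<or> (\<exists>y. reaches (step x) y \<and>
        (\<exists>s. Inv s \<and> y = (While r t c # k, s))))"
      by (auto simp: x)
  qed (use assms(1) in blast)
qed

lemma loops_While_step:
  assumes "s r \<noteq> s t" "runs c s s'" "loops (While r t c) s'"
  shows "loops (While r t c) s"
  unfolding loops_def
  by (rule allI, rule diverges_step)
    (use assms in \<open>auto simp: loops_def runs_def intro: diverges_if_reaches\<close>)

lemma loops_While_body: "s r \<noteq> s t \<Longrightarrow> loops c s \<Longrightarrow> loops (While r t c) s"
  by (rule loops_While_coinduct[where Inv = "(=) s"]) auto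

text \<open>Register \<open>0\<close> provides the constant \<open>0\<close>. The arguments are in
  the registers \<open>xs\<close>, the result goes to \<open>b\<close>, and all registers above \<open>b\<close> are scratch space.\<close>

definition implements :: "com \<Rightarrow> recf \<Rightarrow> nat list \<Rightarrow> nat \<Rightarrow> bool" where
  "implements c p xs b \<longleftrightarrow> (\<forall>s. s 0 = 0 \<longrightarrow>
     (\<forall>z. computes p (map s xs) z \<longrightarrow> (\<exists>s'. runs c s s' \<and> s' b = z \<and> (\<forall>r<b. s' r = s r))) \<and>
     ((\<nexists>z. computes p (map s xs) z) \<longrightarrow> loops c s))"

text \<open>The positions of arguments and result are arbitrary, so that subprograms can be placed
  above all registers that are still in use.\<close>

definition implementable :: "recf \<Rightarrow> bool" where
  "implementable p \<longleftrightarrow> (\<forall>xs b. 0 < b \<longrightarrow> set xs \<subseteq> {..<b} \<longrightarrow> (\<exists>c. implements c p xs b))"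

lemma implementableD:
  "implementable p \<Longrightarrow> 0 < b \<Longrightarrow> set xs \<subseteq> {..<b} \<Longrightarrow> \<exists>c. implements c p xs b"
  unfolding implementable_def by blast

lemma implements_runs:
  "implements c p xs b \<Longrightarrow> s 0 = 0 \<Longrightarrow> computes p (map s xs) z \<Longrightarrow>
    \<exists>s'. runs c s s' \<and> s' b = z \<and> (\<forall>r<b. s' r = s r)"
  unfolding implements_def by blast

lemma implements_loops:
  "implements c p xs b \<Longrightarrow> s 0 = 0 \<Longrightarrow> \<nexists>z. computes p (map s xs) z \<Longrightarrow> loops c s"
  unfolding implements_def by blast

section \<open>Compilation of partial recursive functions\<close>

text \<open>Serves argument lists of the wrong length. Register \<open>b\<close> is made positive
  and only ever increased, so it never equals register 0.\<close>

lemma implements_nowhere: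
  assumes "\<And>s z. \<not> computes p (map s xs) z" "0 < b"
  shows "\<exists>c. implements c p xs b"
proof -
  have "loops (Seq (Asg b 0 1) (While b 0 (Asg b 0 1))) s" if "s 0 = 0" for s
    by (rule loops_Seq2[OF runs_Asg],
        rule loops_While_coinduct[where Inv = "\<lambda>s. s 0 = 0 \<and> s b \<noteq> 0"])
      (use that assms(2) in \<open>auto intro!: exI runs_Asg\<close>)
  then show ?thesis unfolding implements_def using assms(1) by blast
qed

lemma implements_Asg:
  assumes "\<And>s. s 0 = 0 \<Longrightarrow> computes p (map s xs) (s r + i)"
  shows "implements (Asg b r i) p xs b"
  unfolding implements_def
proof (intro allI impI conjI)
  fix s :: "nat \<Rightarrow> nat" and z assume s: "s 0 = 0" "computes p (map s xs) z"
  then have "z = s r + i" using assms computes_functional by blast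
  then show "\<exists>s'. runs (Asg b r i) s s' \<and> s' b = z \<and> (\<forall>r<b. s' r = s r)"
    by (intro exI[of _ "s(b := s r + i)"]) (simp add: runs_Asg)
next
  fix s :: "nat \<Rightarrow> nat" assume "s 0 = 0" "\<nexists>z. computes p (map s xs) z"
  then show "loops (Asg b r i) s" using assms by blast
qed

lemma map_upt_cons: "map s [b..<b + Suc n] = s b # map s [Suc b..<Suc b + n]"
  by (simp del: upt_Suc add: upt_conv_Cons)

lemma map_cong_below: "set xs \<subseteq> {..<b::nat} \<Longrightarrow> \<forall>r<b. s' r = s r \<Longrightarrow> map s' xs = map s xs"
  by auto

text \<open>The programs run one after the other, the result of each being stored just below the
  scratch space of the next. The first program without a value makes the whole sequence
  loop.\<close>

lemma implements_list:
  assumes "\<And>q. q \<in> set qs \<Longrightarrow> implementable q" "0 < b" "set xs \<subseteq> {..<b}"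
  shows "\<exists>c. \<forall>s. s 0 = 0 \<longrightarrow>
     (\<forall>ys. list_all2 (\<lambda>q y. computes q (map s xs) y) qs ys \<longrightarrow>
       (\<exists>s'. runs c s s' \<and> map s' [b..<b + length qs] = ys \<and> (\<forall>r<b. s' r = s r))) \<and>
     ((\<nexists>ys. list_all2 (\<lambda>q y. computes q (map s xs) y) qs ys) \<longrightarrow> loops c s)"
  using assms
proof (induction qs arbitrary: b)
  case Nil
  have "runs (Asg 0 0 0) s s" for s using runs_Asg[of 0 0 0 s] by simp
  then show ?case by auto
next
  case (Cons q qs)
  have "implementable q" using Cons.prems(1) by simp
  then obtain c where "implements c q xs b"
    using implementableD Cons.prems(2,3) by blast
  note c = implements_runs[OF this] and c_loops = implements_loops[OF this]
  have bd: "set xs \<subseteq> {..<Suc b}" using Cons.prems(3) by auto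
  obtain d where d: "\<And>s ys. s 0 = 0 \<Longrightarrow> list_all2 (\<lambda>q y. computes q (map s xs) y) qs ys \<Longrightarrow>
       \<exists>s'. runs d s s' \<and> map s' [Suc b..<Suc b + length qs] = ys \<and> (\<forall>r<Suc b. s' r = s r)"
    and d_loops: "\<And>s. s 0 = 0 \<Longrightarrow> \<nexists>ys. list_all2 (\<lambda>q y. computes q (map s xs) y) qs ys \<Longrightarrow> loops d s"
    using Cons.IH[OF Cons.prems(1)[OF list.set_intros(2)] zero_less_Suc bd] by metis
  show ?case
  proof (rule exI[of _ "Seq c d"], intro allI impI conjI)
    fix s :: "nat \<Rightarrow> nat" and zs assume s: "s 0 = 0" "list_all2 (\<lambda>q y. computes q (map s xs) y) (q # qs) zs"
    then obtain y ys where y: "zs = y # ys" "computes q (map s xs) y"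
      "list_all2 (\<lambda>q y. computes q (map s xs) y) qs ys"
      by (auto simp: list_all2_Cons1)
    obtain s1 where s1: "runs c s s1" "s1 b = y" "\<forall>r<b. s1 r = s r" using c[OF s(1) y(2)] by blast
    have xs1: "map s1 xs = map s xs" by (rule map_cong_below[OF Cons.prems(3) s1(3)])
    have "s1 0 = 0" using s1(3) s(1) Cons.prems(2) by simp
    then obtain s2 where s2: "runs d s1 s2" "map s2 [Suc b..<Suc b + length qs] = ys" "\<forall>r<Suc b. s2 r = s1 r"
      using d[of s1, unfolded xs1, OF _ y(3)] by blast
    have "map s2 [b..<b + length (q # qs)] = zs"
      unfolding list.size(4) One_nat_def add_Suc_right add_0_right map_upt_cons[unfolded add_Suc_right]
      using s2(2,3) s1(2) y(1) by simp
    then show "\<exists>s'. runs (Seq c d) s s' \<and> map s' [b..<b + length (q # qs)] = zs \<and> (\<forall>r<b. s' r = s r)"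
      using runs_Seq[OF s1(1) s2(1)] s1(3) s2(3) by auto
  next
    fix s :: "nat \<Rightarrow> nat" assume s: "s 0 = 0" "\<nexists>ys. list_all2 (\<lambda>q y. computes q (map s xs) y) (q # qs) ys"
    show "loops (Seq c d) s"
    proof (cases "\<exists>y. computes q (map s xs) y")
      case False
      then show ?thesis using c_loops[of s, OF s(1)] loops_Seq1 by blast
    next
      case True
      then obtain y where y: "computes q (map s xs) y" by blast
      obtain s1 where s1: "runs c s s1" "s1 b = y" "\<forall>r<b. s1 r = s r" using c[OF s(1) y] by blast
      have "map s1 xs = map s xs" by (rule map_cong_below[OF Cons.prems(3) s1(3)])
      moreover have "\<nexists>ys. list_all2 (\<lambda>q y. computes q (map s xs) y) qs ys"
        using y s(2) by blast
      ultimately have "loops d s1" using d_loops[of s1] s1(3) s(1) Cons.prems(2) by (simp del: map_eq_conv)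
      then show ?thesis by (rule loops_Seq2[OF s1(1)])
    qed
  qed
qed

text \<open>The values of \<open>qs\<close> occupy the registers from \<open>b\<close> on;
  \<open>p\<close> reads them there and works above them, and its result is copied down to
  \<open>b\<close>.\<close>

lemma implementable_Comp:
  assumes "implementable p" "\<And>q. q \<in> set qs \<Longrightarrow> implementable q"
  shows "implementable (Comp p qs)"
  unfolding implementable_def
proof (intro allI impI)
  fix xs :: "nat list" and b :: nat assume b: "0 < b" and xs: "set xs \<subseteq> {..<b}"
  let ?n = "length qs"
  obtain c where c: "\<And>s ys. s 0 = 0 \<Longrightarrow> list_all2 (\<lambda>q y. computes q (map s xs) y) qs ys \<Longrightarrow>
       \<exists>s'. runs c s s' \<and> map s' [b..<b + ?n] = ys \<and> (\<forall>r<b. s' r = s r)"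
    and c_loops: "\<And>s. s 0 = 0 \<Longrightarrow> \<nexists>ys. list_all2 (\<lambda>q y. computes q (map s xs) y) qs ys \<Longrightarrow> loops c s"
    using implements_list[OF assms(2) b xs] by metis
  have bd: "0 < b + ?n" "set [b..<b + ?n] \<subseteq> {..<b + ?n}" using b by auto
  obtain d where "implements d p [b..<b + ?n] (b + ?n)"
    using implementableD[OF assms(1) bd] by blast
  note d = implements_runs[OF this] and d_loops = implements_loops[OF this]
  have "implements (Seq c (Seq d (Asg b (b + ?n) 0))) (Comp p qs) xs b"
    unfolding implements_def
  proof (intro allI impI conjI)
    fix s :: "nat \<Rightarrow> nat" and z assume s: "s 0 = 0" "computes (Comp p qs) (map s xs) z"
    then obtain ys where ys: "list_all2 (\<lambda>q y. computes q (map s xs) y) qs ys" "computes p ys z"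
      by (auto elim: computes_cases(4))
    obtain s1 where s1: "runs c s s1" "map s1 [b..<b + ?n] = ys" "\<forall>r<b. s1 r = s r"
      using c[OF s(1) ys(1)] by blast
    obtain s2 where s2: "runs d s1 s2" "s2 (b + ?n) = z" "\<forall>r<b + ?n. s2 r = s1 r"
      using d[of s1 z] s1 s b ys by auto
    show "\<exists>s'. runs (Seq c (Seq d (Asg b (b + ?n) 0))) s s' \<and> s' b = z \<and> (\<forall>r<b. s' r = s r)"
      by (rule exI, intro conjI, rule runs_Seq[OF s1(1) runs_Seq[OF s2(1) runs_Asg]])
        (use s1 s2 in auto)
  next
    fix s :: "nat \<Rightarrow> nat" assume s: "s 0 = 0" "\<nexists>z. computes (Comp p qs) (map s xs) z"
    show "loops (Seq c (Seq d (Asg b (b + ?n) 0))) s"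
    proof (cases "\<exists>ys. list_all2 (\<lambda>q y. computes q (map s xs) y) qs ys")
      case False
      then show ?thesis by (intro loops_Seq1 c_loops s(1))
    next
      case True
      then obtain ys where ys: "list_all2 (\<lambda>q y. computes q (map s xs) y) qs ys" by blast
      obtain s1 where s1: "runs c s s1" "map s1 [b..<b + ?n] = ys" "\<forall>r<b. s1 r = s r"
        using c[OF s(1) ys(1)] by blast
      have "\<nexists>z. computes p ys z" using s(2) ys computes.Comp by blast
      then have "loops d s1" using d_loops[of s1] s1 s(1) b by simp
      then show ?thesis using loops_Seq2[OF s1(1) loops_Seq1] by blast
    qed
  qed
  then show "\<exists>c. implements c (Comp p qs) xs b" by blast
qed

text \<open>Each stage of the recursion is computed from the preceding one. Hence a missing value at
  one stage leaves all later stages without a value.\<close>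

lemma computes_PrimRec_below:
  "computes (PrimRec p q) (n # ys) z \<Longrightarrow> i \<le> n \<Longrightarrow> \<exists>w. computes (PrimRec p q) (i # ys) w"
proof (induction n arbitrary: z)
  case (Suc n)
  from Suc.prems(1) obtain y where "computes (PrimRec p q) (n # ys) y" by (rule computes_cases)
  then show ?case using Suc by (metis le_SucE)
qed auto

text \<open>Register \<open>b\<close> accumulates the value, \<open>b + 1\<close> counts up to the
  contents of \<open>x\<close>, and \<open>b + 2\<close> receives the result of
  \<open>q\<close>.\<close>

lemma implementable_PrimRec:
  assumes "implementable p" "implementable q"
  shows "implementable (PrimRec p q)"
  unfolding implementable_def
proof (intro allI impI)
  fix xxs :: "nat list" and b :: nat assume b: "0 < b" and xxs: "set xxs \<subseteq> {..<b}"
  show "\<exists>c. implements c (PrimRec p q) xxs b"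
  proof (cases xxs)
    case Nil
    \<comment> \<open>No evaluation rule of a primitive recursion fits an empty argument list, so a
      looping program is required.\<close>
    have "\<not> computes (PrimRec p q) [] z" for z
      by (auto elim: computes.cases)
    then show ?thesis using Nil b by (intro implements_nowhere) auto
  next
    case (Cons x xs)
    then have x: "x < b" and xs: "set xs \<subseteq> {..<b}" using xxs by auto
    obtain c where "implements c p xs b"
      using implementableD[OF assms(1) b xs] by blast
    note c = implements_runs[OF this] and c_loops = implements_loops[OF this]
    have bd: "0 < b + 2" "set (b # (b + 1) # xs) \<subseteq> {..<b + 2}" using b xs by auto
    obtain d where "implements d q (b # (b + 1) # xs) (b + 2)"
      using implementableD[OF assms(2) bd] by blast
    note d = implements_runs[OF this] and d_loops = implements_loops[OF this]
    define body where "body = Seq d (Seq (Asg b (b + 2) 0) (Asg (b + 1) (b + 1) 1))"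
    have body: "\<exists>s'. runs body s s' \<and> s' b = z \<and> s' (b + 1) = s (b + 1) + 1 \<and> (\<forall>r<b. s' r = s r)"
      if s: "s 0 = 0" and z: "computes q (s b # s (b + 1) # map s xs) z" for s z
    proof -
      obtain s1 where s1: "runs d s s1" "s1 (b + 2) = z" "\<forall>r<b + 2. s1 r = s r"
        using d[of s z, unfolded list.map, OF s z] by blast
      show ?thesis unfolding body_def
        by (rule exI, intro conjI, rule runs_Seq[OF s1(1) runs_Seq[OF runs_Asg runs_Asg]])
          (use s1 in auto)
    qed
    have body_loops: "loops body s" if "s 0 = 0" "\<nexists>z. computes q (s b # s (b + 1) # map s xs) z" for s
      unfolding body_def using d_loops that by (intro loops_Seq1) auto
    let ?W = "While (b + 1) x body"
    \<comment> \<open>Loop invariant: the accumulator is the value of the recursion at the counter.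
      The induction is on the number of passes left.\<close>
    have W: "(\<forall>z. computes (PrimRec p q) (s x # map s xs) z \<longrightarrow>
          (\<exists>s'. runs ?W s s' \<and> s' b = z \<and> (\<forall>r<b. s' r = s r))) \<and>
        ((\<nexists>z. computes (PrimRec p q) (s x # map s xs) z) \<longrightarrow> loops ?W s)"
      if "s 0 = 0" "s (b + 1) \<le> s x" "computes (PrimRec p q) (s (b + 1) # map s xs) (s b)" for s
      using that
    proof (induction "s x - s (b + 1)" arbitrary: s)
      case 0
      then have eq: "s (b + 1) = s x" by simp
      have "z = s b" if "computes (PrimRec p q) (s x # map s xs) z" for z
        using computes_functional[OF that] 0 eq by simp
      moreover have "runs ?W s s" using eq by (rule runs_While_done)
      ultimately show ?case using 0(4) eq by auto
    next
      case (Suc m)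
      have neq: "s (b + 1) \<noteq> s x" using Suc(2) by linarith
      show ?case
      proof (cases "\<exists>w. computes q (s b # s (b + 1) # map s xs) w")
        case True
        then obtain w where w: "computes q (s b # s (b + 1) # map s xs) w" by blast
        obtain s1 where s1: "runs body s s1" "s1 b = w" "s1 (b + 1) = s (b + 1) + 1" "\<forall>r<b. s1 r = s r"
          using body[OF Suc(3) w] by blast
        have eqs: "s1 0 = 0" "s1 x = s x" "map s1 xs = map s xs"
          using s1(4) b x Suc(3) map_cong_below[OF xs s1(4)] by auto
        have "computes (PrimRec p q) (s1 (b + 1) # map s1 xs) (s1 b)"
          unfolding eqs s1(2,3) using computes.PrimRec_Suc[OF Suc(5) w] by simp
        with Suc(1)[of s1] Suc(2,3,4) neq eqs s1
        have IH: "(\<forall>z. computes (PrimRec p q) (s x # map s xs) z \<longrightarrow>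
          (\<exists>s'. runs ?W s1 s' \<and> s' b = z \<and> (\<forall>r<b. s' r = s r))) \<and>
            ((\<nexists>z. computes (PrimRec p q) (s x # map s xs) z) \<longrightarrow> loops ?W s1)"
          by (simp del: map_eq_conv)
        show ?thesis using IH runs_While_step[of s "b + 1" x, OF neq s1(1)]
          loops_While_step[of s "b + 1" x, OF neq s1(1)] by blast
      next
        case False
        \<comment> \<open>A value at \<open>s x\<close> would yield one at the next stage, hence a
          value of \<open>q\<close> at the present accumulator, which is unique.\<close>
        have "\<not> computes (PrimRec p q) (s x # map s xs) z" for z
        proof
          assume "computes (PrimRec p q) (s x # map s xs) z"
          then obtain w where "computes (PrimRec p q) (Suc (s (b + 1)) # map s xs) w"
            using computes_PrimRec_below[where i = "Suc (s (b + 1))"] Suc(4) neq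
            by (metis Suc_leI le_neq_implies_less)
          then show False
            using False computes_functional[OF Suc(5)] by (auto elim!: computes_cases(6))
        qed
        then show ?thesis using loops_While_body[of s "b + 1" x, OF neq] body_loops[of s, OF Suc(3)] False by blast
      qed
    qed
    have "implements (Seq c (Seq (Asg (b + 1) 0 0) ?W)) (PrimRec p q) (x # xs) b"
      unfolding implements_def
    proof (intro allI impI)
      fix s :: "nat \<Rightarrow> nat" assume s: "s 0 = 0"
      show "(\<forall>z. computes (PrimRec p q) (map s (x # xs)) z \<longrightarrow>
          (\<exists>s'. runs (Seq c (Seq (Asg (b + 1) 0 0) ?W)) s s' \<and> s' b = z \<and> (\<forall>r<b. s' r = s r))) \<and>
         ((\<nexists>z. computes (PrimRec p q) (map s (x # xs)) z) \<longrightarrow> loops (Seq c (Seq (Asg (b + 1) 0 0) ?W)) s)"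
      proof (cases "\<exists>y. computes p (map s xs) y")
        case True
        then obtain y where y: "computes p (map s xs) y" by blast
        obtain s1 where s1: "runs c s s1" "s1 b = y" "\<forall>r<b. s1 r = s r" using c[OF s y] by blast
        define s2 where "s2 = s1(b + 1 := s1 0 + 0)"
        have run: "runs c s s1" "runs (Asg (b + 1) 0 0) s1 s2"
          unfolding s2_def by (rule s1 runs_Asg)+
        have below: "\<forall>r<b. s2 r = s r" using s1(3) by (simp add: s2_def)
        have eqs: "s2 0 = 0" "s2 x = s x" "s2 (b + 1) = 0" "s2 b = y"
          using below b x s s1 by (auto simp: s2_def)
        have xs2: "map s2 xs = map s xs" by (rule map_cong_below[OF xs below])
        have "computes (PrimRec p q) (s2 (b + 1) # map s2 xs) (s2 b)"
          unfolding eqs xs2 using y by (rule computes.PrimRec_0)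
        from W[OF eqs(1) _ this, unfolded eqs xs2]
        show ?thesis using runs_Seq[OF run(1) runs_Seq[OF run(2)]]
            loops_Seq2[OF run(1) loops_Seq2[OF run(2)]] below
          by (simp only: list.map) (metis le0)
      next
        case False
        have "\<not> computes (PrimRec p q) (s x # map s xs) z" for z
        proof
          assume "computes (PrimRec p q) (s x # map s xs) z"
          then obtain w where "computes (PrimRec p q) (0 # map s xs) w"
            using computes_PrimRec_below by blast
          with False show False by (auto elim: computes_cases(5))
        qed
        moreover have "loops c s" using c_loops s False by blast
        ultimately show ?thesis by (auto intro: loops_Seq1)
      qed
    qed
    then show ?thesis using Cons by blast
  qed
qed

text \<open>Register \<open>b\<close> holds the candidate and \<open>b + 1\<close> the value of
  \<open>p\<close> there; the loop runs until this value is 0.\<close>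

lemma implementable_Mu:
  assumes "implementable p"
  shows "implementable (Mu p)"
  unfolding implementable_def
proof (intro allI impI)
  fix xs :: "nat list" and b :: nat assume b: "0 < b" and xs: "set xs \<subseteq> {..<b}"
  have bd: "0 < b + 1" "set (b # xs) \<subseteq> {..<b + 1}" using xs by auto
  obtain d where "implements d p (b # xs) (b + 1)"
    using implementableD[OF assms bd] by blast
  note d = implements_runs[OF this] and d_loops = implements_loops[OF this]
  \<comment> \<open>The general source \<open>r\<close> and increment \<open>i\<close> cover both
    the first candidate (\<open>0\<close>, \<open>0\<close>) and the passage to the next one
    (\<open>b\<close>, \<open>1\<close>).\<close>
  have set_run: "\<exists>s'. runs (Seq (Asg b r i) d) s s' \<and> s' b = s r + i \<and> s' (b + 1) = z \<and> (\<forall>r<b. s' r = s r)"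
    if s: "s 0 = 0" and z: "computes p ((s r + i) # map s xs) z" for r i s z
  proof -
    let ?s1 = "s(b := s r + i)"
    have "map ?s1 xs = map s xs" by (rule map_cong_below[OF xs]) simp
    then have "computes p (map ?s1 (b # xs)) z" using z by (simp only: list.map fun_upd_same)
    then obtain s2 where s2: "runs d ?s1 s2" "s2 (b + 1) = z" "\<forall>r<b + 1. s2 r = ?s1 r"
      using d[of ?s1 z] s b by auto
    then show ?thesis using runs_Seq[OF runs_Asg s2(1)] by auto
  qed
  have set_loops: "loops (Seq (Asg b r i) d) s"
    if s: "s 0 = 0" and z: "\<nexists>z. computes p ((s r + i) # map s xs) z" for r i s
  proof -
    let ?s1 = "s(b := s r + i)"
    have "map ?s1 xs = map s xs" by (rule map_cong_below[OF xs]) simp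
    then have "\<nexists>z. computes p (map ?s1 (b # xs)) z" using z by (simp del: map_eq_conv)
    then show ?thesis using loops_Seq2[OF runs_Asg d_loops[of ?s1]] s b by simp
  qed
  let ?B = "Seq (Asg b b 1) d"
  let ?W = "While (b + 1) 0 ?B"
  have W: "\<exists>s'. runs ?W s s' \<and> s' b = n \<and> (\<forall>r<b. s' r = s r)"
    if "s 0 = 0" "s b \<le> n" "computes p (s b # map s xs) (s (b + 1))" "computes (Mu p) (map s xs) n" for s n
    using that
  proof (induction "n - s b" arbitrary: s)
    case 0
    then have eq: "s b = n" by simp
    have "computes p (n # map s xs) 0" using 0(5) by (auto elim: computes_cases(7))
    then have "s (b + 1) = 0" using computes_functional 0(4) eq by blast
    then have "runs ?W s s" using 0(2) by (intro runs_While_done) simp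
    then show ?case using eq by blast
  next
    case (Suc m)
    then have less: "s b < n" by linarith
    from Suc(6) have Mu: "computes p (n # map s xs) 0" "\<And>m. m < n \<Longrightarrow> \<exists>y. computes p (m # map s xs) (Suc y)"
      by (auto elim!: computes_cases(7))
    have neq: "s (b + 1) \<noteq> s 0" using Mu(2)[OF less] computes_functional[OF Suc(5)] Suc(3) by auto
    obtain z where z: "computes p ((s b + 1) # map s xs) z"
      using Mu(1) Mu(2)[of "s b + 1"] less by (cases "s b + 1 = n") auto
    obtain s1 where s1: "runs ?B s s1" "s1 b = s b + 1" "s1 (b + 1) = z" "\<forall>r<b. s1 r = s r"
      using set_run[OF Suc(3) z] by blast
    have eqs: "s1 0 = 0" "map s1 xs = map s xs"
      using s1(4) b Suc(3) map_cong_below[OF xs s1(4)] by auto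
    have "\<exists>s'. runs ?W s1 s' \<and> s' b = n \<and> (\<forall>r<b. s' r = s1 r)"
      by (rule Suc(1)) (use Suc(2,6) s1 eqs z less in \<open>simp_all del: map_eq_conv\<close>)
    then show ?case using runs_While_step[of s "b + 1" 0, OF neq s1(1)] s1(4) by auto
  qed
  have W_loops: "loops ?W s"
    if "s 0 = 0" "s b = 0" "computes p (s b # map s xs) (s (b + 1))" "\<nexists>n. computes (Mu p) (map s xs) n" for s
  \<comment> \<open>Invariant: all smaller candidates have positive values. If the current value
    were 0, the candidate would be the value of \<open>Mu p\<close>.\<close>
  proof (rule loops_While_coinduct[where Inv = "\<lambda>t. t 0 = 0 \<and> map t xs = map s xs \<and>
      computes p (t b # map s xs) (t (b + 1)) \<and> (\<forall>m<t b. \<exists>y. computes p (m # map s xs) (Suc y))"])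
    fix t :: "nat \<Rightarrow> nat"
    assume Inv: "t 0 = 0 \<and> map t xs = map s xs \<and>
      computes p (t b # map s xs) (t (b + 1)) \<and> (\<forall>m<t b. \<exists>y. computes p (m # map s xs) (Suc y))"
    have nz: "t (b + 1) \<noteq> 0" using Inv that(4) computes.Mu by metis
    then have pos: "\<exists>y. computes p (t b # map s xs) (Suc y)" using Inv by (metis not0_implies_Suc)
    have "loops ?B t \<or> (\<exists>t'. runs ?B t t' \<and> t' 0 = 0 \<and> map t' xs = map s xs \<and>
      computes p (t' b # map s xs) (t' (b + 1)) \<and> (\<forall>m<t' b. \<exists>y. computes p (m # map s xs) (Suc y)))"
    proof (cases "\<exists>z. computes p ((t b + 1) # map t xs) z")
      case False
      then show ?thesis using set_loops Inv by blast
    next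
      case True
      then obtain z where z: "computes p ((t b + 1) # map t xs) z" by blast
      obtain t' where t': "runs ?B t t'" "t' b = t b + 1" "t' (b + 1) = z" "\<forall>r<b. t' r = t r"
        using set_run[OF conjunct1[OF Inv] z] by blast
      have eqs: "t' 0 = 0" "map t' xs = map s xs"
        using t'(4) b Inv map_cong_below[OF xs t'(4)] by (simp_all del: map_eq_conv)
      show ?thesis
        by (intro disjI2 exI[of _ t']) (use t' z Inv eqs pos in \<open>auto simp: less_Suc_eq\<close>)
    qed
    with nz Inv show "t (b + 1) \<noteq> t 0 \<and> (loops ?B t \<or> (\<exists>t'. runs ?B t t' \<and> t' 0 = 0 \<and> map t' xs = map s xs \<and>
      computes p (t' b # map s xs) (t' (b + 1)) \<and> (\<forall>m<t' b. \<exists>y. computes p (m # map s xs) (Suc y))))"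
      by simp
  qed (use that in auto)
  have "implements (Seq (Seq (Asg b 0 0) d) ?W) (Mu p) xs b"
    unfolding implements_def
  proof (intro allI impI)
    fix s :: "nat \<Rightarrow> nat" assume s: "s 0 = 0"
    show "(\<forall>z. computes (Mu p) (map s xs) z \<longrightarrow>
          (\<exists>s'. runs (Seq (Seq (Asg b 0 0) d) ?W) s s' \<and> s' b = z \<and> (\<forall>r<b. s' r = s r))) \<and>
         ((\<nexists>z. computes (Mu p) (map s xs) z) \<longrightarrow> loops (Seq (Seq (Asg b 0 0) d) ?W) s)"
    proof (cases "\<exists>y. computes p (0 # map s xs) y")
      case True
      then obtain y where y: "computes p ((s 0 + 0) # map s xs) y" using s by auto
      obtain s1 where s1: "runs (Seq (Asg b 0 0) d) s s1" "s1 b = 0" "s1 (b + 1) = y" "\<forall>r<b. s1 r = s r"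
        using set_run[OF s y] s by auto
      have eqs: "s1 0 = 0" "map s1 xs = map s xs"
        using s1(4) b s map_cong_below[OF xs s1(4)] by auto
      have y': "computes p (s1 b # map s1 xs) (s1 (b + 1))" unfolding eqs s1(2,3) using y s by simp
      show ?thesis
        using W[OF eqs(1) _ y'] W_loops[OF eqs(1) s1(2) y'] runs_Seq[OF s1(1)] loops_Seq2[OF s1(1)] s1(2,4)
        unfolding eqs by (metis le0)
    next
      case False
      then have "loops (Seq (Asg b 0 0) d) s" using set_loops s by simp
      moreover have "\<not> computes (Mu p) (map s xs) z" for z
        using False by (cases z) (auto elim!: computes_cases(7))
      ultimately show ?thesis by (auto intro: loops_Seq1)
    qed
  qed
  then show "\<exists>c. implements c (Mu p) xs b" by blast
qed

lemma implementable: "implementable p"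
proof (induction p)
  case Zero
  show ?case unfolding implementable_def
    by (intro allI impI, rule exI, rule implements_Asg[where r = 0 and i = 0]) (simp add: computes.Zero)
next
  case Succ
  show ?case unfolding implementable_def
  proof (intro allI impI)
    fix xs :: "nat list" and b :: nat assume "0 < b"
    show "\<exists>c. implements c Succ xs b"
    proof (cases "\<exists>x. xs = [x]")
      case True
      then obtain x where "xs = [x]" ..
      then have "implements (Asg b x 1) Succ xs b"
        by (intro implements_Asg) (simp add: computes.Succ)
      then show ?thesis ..
    next
      case False
      then show ?thesis using \<open>0 < b\<close>
        by (intro implements_nowhere) (auto elim!: computes_cases(2))
    qed
  qed
next
  case (Proj i)
  show ?case unfolding implementable_def
  proof (intro allI impI)
    fix xs :: "nat list" and b :: nat assume "0 < b"
    show "\<exists>c. implements c (Proj i) xs b"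
    proof (cases "i < length xs")
      case True
      then have "implements (Asg b (xs ! i) 0) (Proj i) xs b"
        using computes.Proj[of i "map _ xs"] by (intro implements_Asg) simp
      then show ?thesis ..
    next
      case False
      then show ?thesis using \<open>0 < b\<close>
        by (intro implements_nowhere) (auto elim!: computes_cases(3))
    qed
  qed
qed (simp_all add: implementable_Comp implementable_PrimRec implementable_Mu)

section \<open>Finiteness of the set of control points\<close>

text \<open>Covers the stacks that control can occupy while \<open>c\<close> runs on top of
  \<open>k\<close>, before \<open>k\<close> is left alone. A loop body returns to the same loop
  stack, which keeps the set finite although stacks are pushed.\<close>

primrec locs :: "com \<Rightarrow> com list \<Rightarrow> com list set" where
  "locs (Asg r s c) k = {Asg r s c # k}"
| "locs (Seq c d) k = insert (Seq c d # k) (locs c (d # k) \<union> locs d k)"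
| "locs (While r s c) k = insert (While r s c # k) (locs c (While r s c # k))"

lemma finite_locs: "finite (locs c k)"
  by (induction c arbitrary: k) auto

lemma start_in_locs: "c # k \<in> locs c k"
  by (cases c) auto

lemma locs_closed:
  "l \<in> locs c k \<Longrightarrow> on_eq (instr l) \<in> insert k (locs c k) \<and> on_neq (instr l) \<in> insert k (locs c k)"
proof (induction c arbitrary: k)
  case (Seq c d)
  show ?case using Seq.prems Seq.IH(1)[of "d # k"] Seq.IH(2)[of k] by (auto simp: start_in_locs)
qed (auto simp: start_in_locs)

lemma ex_com:
  "\<exists>c. \<forall>y. ((\<exists>z. computes q [y] z) \<longrightarrow> (\<exists>n. fst ((step ^^ n) ([c], \<lambda>r. if r = 1 then y else 0)) = [])) \<and>
     ((\<nexists>z. computes q [y] z) \<longrightarrow> diverges ([c], \<lambda>r. if r = 1 then y else 0))"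
proof -
  \<comment> \<open>The argument sits in register 1 and the result goes to register 2; register 0
    stays reserved for the constant.\<close>
  obtain c where c: "implements c q [1] 2" using implementableD[OF implementable, of 2 "[1]"] by auto
  have "\<exists>n. fst ((step ^^ n) ([c], \<lambda>r. if r = 1 then y else 0)) = []" if "computes q [y] z" for y z
  proof -
    from implements_runs[OF c, of "\<lambda>r. if r = 1 then y else 0" z] that
    obtain s where "runs c (\<lambda>r. if r = 1 then y else 0) s" by auto
    then have "reaches ([c], \<lambda>r. if r = 1 then y else 0) ([], s)" unfolding runs_def by blast
    then show ?thesis unfolding reaches_def by (metis fst_conv)
  qed
  moreover have "diverges ([c], \<lambda>r. if r = 1 then y else 0)" if "\<nexists>z. computes q [y] z" for y
    using implements_loops[OF c, of "\<lambda>r. if r = 1 then y else 0"] that unfolding loops_def by simp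
  ultimately show ?thesis by blast
qed


section \<open>Difference polynomials\<close>

lemma eval_mpoly_uminus:
  fixes h :: "'a::ab_group_add \<Rightarrow> 'b::comm_ring_1"
  assumes "h 0 = 0" "\<And>a b. h (a + b) = h a + h b"
  shows "eval_mpoly h r (- p) = - eval_mpoly h r p"
proof -
  have "eval_mpoly h r (- p) + eval_mpoly h r p = eval_mpoly h r 0"
    using eval_mpoly_add[of h r "- p" p, OF assms] by simp
  then show ?thesis by (simp add: eval_mpoly_def eq_neg_iff_add_eq_0)
qed

lemma eval_mpoly_diff:
  fixes h :: "'a::ab_group_add \<Rightarrow> 'b::comm_ring_1"
  assumes "h 0 = 0" "\<And>a b. h (a + b) = h a + h b"
  shows "eval_mpoly h r (p - q) = eval_mpoly h r p - eval_mpoly h r q"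
  using eval_mpoly_add[of h r p "- q", OF assms] eval_mpoly_uminus[of h r q, OF assms] by simp

lemma Const_0: "Const 0 = 0"
  by (simp add: Const_def)

lemma Const_1: "Const 1 = 1"
  by (simp add: Const_def)

lemma Const_add: "Const (a + b) = Const a + Const b"
  by (simp add: Const_def single_add)

lemma Const_mult: "Const (a * b) = Const a * (Const b :: ('v, 'a::semiring_0) mpoly)"
  by (simp add: Const_def mult_single)

lemma Const_uminus: "Const (- a) = - (Const a :: ('v, 'a::ab_group_add) mpoly)"
  by (simp add: Const_def single_uminus)

lemma Const_diff: "Const (a - b) = Const a - (Const b :: ('v, 'a::ab_group_add) mpoly)"
  by (simp add: Const_def single_diff)

lemma Const_of_nat: "Const (of_nat i) = (of_nat i :: ('v, 'a::semiring_1) mpoly)"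
  by (induction i) (simp_all add: Const_0 Const_1 Const_add)

lemmas eval_id = eval_mpoly_add[of "\<lambda>a. a"] eval_mpoly_mult[of "\<lambda>a. a"]
  eval_mpoly_diff[of "\<lambda>a. a"] eval_mpoly_uminus[of "\<lambda>a. a"] eval_mpoly_Const[of "\<lambda>a. a"] eval_mpoly_Var[of "\<lambda>a. a"]

lemma eval_id_1: "eval_mpoly (\<lambda>a. a) r 1 = 1"
  using eval_mpoly_Const[of "\<lambda>a. a" r 1] by (simp add: Const_1)

lemma eval_id_power: "eval_mpoly (\<lambda>a. a) r (p ^ e) = eval_mpoly (\<lambda>a. a) r p ^ e"
  for p :: "('v, 'a::comm_semiring_1) mpoly"
  by (induction e) (simp_all add: eval_id eval_id_1)

lemma dpoly_shift_simps:
  "dpoly_shift m (p + q) = dpoly_shift m p + dpoly_shift m q"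
  "dpoly_shift m (p - q) = dpoly_shift m p - dpoly_shift m q"
  "dpoly_shift m (p * q) = dpoly_shift m p * dpoly_shift m q"
  "dpoly_shift m (Const a) = Const a"
  "dpoly_shift m (Var (i, j)) = Var (i, m + j)"
  "dpoly_shift m 1 = 1"
  "dpoly_shift m (of_nat k) = of_nat k"
  unfolding dpoly_shift_def
  using eval_mpoly_Const[of Const "\<lambda>(i, j). Var (i, m + j)" 1]
    eval_mpoly_Const[of Const "\<lambda>(i, j). Var (i, m + j)" "of_nat k"]
  by (simp_all add: eval_mpoly_add eval_mpoly_mult eval_mpoly_diff eval_mpoly_Const eval_mpoly_Var
      Const_0 Const_1 Const_add Const_mult Const_of_nat)

lemma dpoly_ring_simps:
  "\<zero>\<^bsub>dpoly_ring K n M\<^esub> = 0" "\<one>\<^bsub>dpoly_ring K n M\<^esub> = 1"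
  "a \<oplus>\<^bsub>dpoly_ring K n M\<^esub> b = a + b" "a \<otimes>\<^bsub>dpoly_ring K n M\<^esub> b = a * b"
  by (simp_all add: dpoly_ring_def ring_of_type_algebra_def)

lemma dpoly_ring_nat_pow: "a [^]\<^bsub>dpoly_ring K n M\<^esub> (e::nat) = a ^ e"
  by (induction e) (simp_all add: nat_pow_def dpoly_ring_simps mult.commute)

lemma in_dpoly_ring_iff:
  "f \<in> carrier (dpoly_ring K n M) \<longleftrightarrow> (\<forall>t\<in>Poly_Mapping.keys f.
      Poly_Mapping.lookup f t \<in> K \<and> Poly_Mapping.keys t \<subseteq> {1..n} \<times> M)"
  by (simp add: dpoly_ring_def)

lemma subfield_closed:
  assumes "subfield K (ring_of_type_algebra :: 'k::field ring)"
  shows "0 \<in> K" "1 \<in> K" "a \<in> K \<Longrightarrow> b \<in> K \<Longrightarrow> a + b \<in> K" "a \<in> K \<Longrightarrow> - a \<in> K"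
    "a \<in> K \<Longrightarrow> a \<noteq> 0 \<Longrightarrow> inverse a \<in> K"
proof -
  let ?R = "ring_of_type_algebra :: 'k ring"
  interpret R: cring ?R by (rule cring_from_type_algebra)
  interpret K: subfield K ?R by (rule assms)
  have R_simps: "\<zero>\<^bsub>?R\<^esub> = 0" "\<one>\<^bsub>?R\<^esub> = 1" "\<And>a b. a \<oplus>\<^bsub>?R\<^esub> b = a + b" "\<And>a b. a \<otimes>\<^bsub>?R\<^esub> b = a * b"
    by (simp_all add: ring_of_type_algebra_def)
  show "0 \<in> K" "1 \<in> K" "a \<in> K \<Longrightarrow> b \<in> K \<Longrightarrow> a + b \<in> K"
    using subringE(2,3)[OF K.subring_axioms] subringE(7)[OF K.subring_axioms, of a b]
    by (simp_all add: R_simps)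
  have "\<ominus>\<^bsub>?R\<^esub> a = - a" by (rule R.minus_equality) (simp_all add: ring_of_type_algebra_def)
  then show "a \<in> K \<Longrightarrow> - a \<in> K" using subringE(5)[OF K.subring_axioms, of a] by simp
  show "inverse a \<in> K" if "a \<in> K" "a \<noteq> 0"
  proof -
    have a: "a \<in> K - {\<zero>\<^bsub>?R\<^esub>}" using that by (simp add: R_simps)
    have "a * (inv\<^bsub>?R\<^esub> a) = 1" using R.subfield_m_inv(2)[OF assms a] by (simp add: R_simps)
    then have "inv\<^bsub>?R\<^esub> a = inverse a" by (metis inverse_unique)
    then show ?thesis using R.subfield_m_inv(1)[OF assms a] by simp
  qed
qed

section \<open>Closure properties of the ring of difference polynomials\<close>

locale dpoly_context =
  fixes K :: "'k::field_char_0 set" and M :: "int set"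
  assumes M: "M = \<nat> \<or> M = \<int>"
    and K: "subfield K (ring_of_type_algebra :: 'k ring)"
begin

lemma M_closed: "0 \<in> M" "1 \<in> M" "int t \<in> M" "i \<in> M \<Longrightarrow> j \<in> M \<Longrightarrow> i + j \<in> M"
  using M by auto

lemma K_closed: "0 \<in> K" "1 \<in> K" "a \<in> K \<Longrightarrow> b \<in> K \<Longrightarrow> a + b \<in> K" "a \<in> K \<Longrightarrow> - a \<in> K"
    "a \<in> K \<Longrightarrow> a \<noteq> 0 \<Longrightarrow> inverse a \<in> K"
  using subfield_closed[OF K] by auto

lemma K_of_nat: "of_nat i \<in> K"
  by (induction i) (simp_all add: K_closed)

lemma cring: "cring (dpoly_ring K n M)"
  using K by (rule cring_dpoly_ring)

lemma carrier_add: "f \<in> carrier (dpoly_ring K n M) \<Longrightarrow> g \<in> carrier (dpoly_ring K n M) \<Longrightarrow> f + g \<in> carrier (dpoly_ring K n M)"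
  using cring.cring_simprules(1)[OF cring] by (simp add: dpoly_ring_simps)

lemma carrier_mult: "f \<in> carrier (dpoly_ring K n M) \<Longrightarrow> g \<in> carrier (dpoly_ring K n M) \<Longrightarrow> f * g \<in> carrier (dpoly_ring K n M)"
  using cring.cring_simprules(5)[OF cring] by (simp add: dpoly_ring_simps)

lemma carrier_0: "0 \<in> carrier (dpoly_ring K n M)"
  using cring.cring_simprules(2)[OF cring] by (simp add: dpoly_ring_simps)

lemma carrier_1: "1 \<in> carrier (dpoly_ring K n M)"
  using cring.cring_simprules(6)[OF cring] by (simp add: dpoly_ring_simps)

lemma carrier_uminus: "f \<in> carrier (dpoly_ring K n M) \<Longrightarrow> - f \<in> carrier (dpoly_ring K n M)"
  using K_closed(4) by (auto simp: in_dpoly_ring_iff in_keys_iff)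

lemma carrier_diff: "f \<in> carrier (dpoly_ring K n M) \<Longrightarrow> g \<in> carrier (dpoly_ring K n M) \<Longrightarrow> f - g \<in> carrier (dpoly_ring K n M)"
  using carrier_add[of f n "- g"] carrier_uminus[of g] by simp

lemma carrier_Const: "a \<in> K \<Longrightarrow> Const a \<in> carrier (dpoly_ring K n M)"
  by (simp add: in_dpoly_ring_iff Const_def)

lemma carrier_Var: "i \<in> {1..n} \<Longrightarrow> m \<in> M \<Longrightarrow> Var (i, m) \<in> carrier (dpoly_ring K n M)"
  by (simp add: in_dpoly_ring_iff Var_def K_closed)

lemma carrier_power: "f \<in> carrier (dpoly_ring K n M) \<Longrightarrow> f ^ e \<in> carrier (dpoly_ring K n M)"
  by (induction e) (simp_all add: carrier_1 carrier_mult)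

lemma carrier_sum: "(\<And>a. a \<in> A \<Longrightarrow> f a \<in> carrier (dpoly_ring K n M)) \<Longrightarrow> sum f A \<in> carrier (dpoly_ring K n M)"
  by (induction A rule: infinite_finite_induct) (simp_all add: carrier_0 carrier_add)

lemma carrier_prod: "(\<And>a. a \<in> A \<Longrightarrow> f a \<in> carrier (dpoly_ring K n M)) \<Longrightarrow> prod f A \<in> carrier (dpoly_ring K n M)"
  by (induction A rule: infinite_finite_induct) (simp_all add: carrier_1 carrier_mult)

lemma carrier_dpoly_shift:
  assumes f: "f \<in> carrier (dpoly_ring K n M)" and m: "m \<in> M"
  shows "dpoly_shift m f \<in> carrier (dpoly_ring K n M)"
  unfolding dpoly_shift_def eval_mpoly_def
proof (intro carrier_sum carrier_mult carrier_Const carrier_prod carrier_power)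
  fix t assume t: "t \<in> Poly_Mapping.keys f"
  then show "Poly_Mapping.lookup f t \<in> K" using f by (simp add: in_dpoly_ring_iff)
  fix v assume "v \<in> Poly_Mapping.keys t"
  then have "v \<in> {1..n} \<times> M" using f t by (auto simp: in_dpoly_ring_iff)
  then show "(case v of (i, j) \<Rightarrow> Var (i, m + j)) \<in> carrier (dpoly_ring K n M)"
    using m by (auto intro!: carrier_Var M_closed)
qed

lemma carrier_dpoly_of:
  assumes "e \<in> dpoly_exprs K n M"
  shows "dpoly_of e \<in> carrier (dpoly_ring K n M)"
  using assms
proof (induction e)
  case Nil
  show ?case by (simp add: dpoly_of_def carrier_0)
next
  case (Cons t ts)
  obtain a ps where t: "t = (a, ps)" by (cases t)
  then have a: "a \<in> K" and ps: "ps \<in> lists (({1..n} \<times> M) \<times> UNIV)" and ts: "ts \<in> dpoly_exprs K n M"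
    using Cons.prems by (auto simp: dpoly_exprs_def)
  have "(\<Prod>(v, d)\<leftarrow>ps. Var v ^ d) \<in> carrier (dpoly_ring K n M)"
    using ps by (induction ps) (auto intro!: carrier_1 carrier_mult carrier_power carrier_Var)
  then have "Const a * (\<Prod>(v, d)\<leftarrow>ps. Var v ^ d) \<in> carrier (dpoly_ring K n M)"
    by (intro carrier_mult carrier_Const a)
  with Cons.IH[OF ts] show ?case by (simp add: dpoly_of_def t carrier_add)
qed

text \<open>The easy half of a Nullstellensatz: evaluation at a solution and a time \<open>j\<close>
  is a ring homomorphism to the field whose kernel contains the difference ideal. A power of
  \<open>g\<close> vanishes there, hence \<open>g\<close> itself.\<close>

lemma in_radical_imp_not_solvable:
  assumes F: "F \<subseteq> carrier (dpoly_ring K n M)" and g: "in_radical_diff_ideal K M n F g"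
  shows "\<not> solvable_in_seqs M n F g"
proof
  let ?R = "dpoly_ring K n M"
  let ?G = "{dpoly_shift m f |m f. m \<in> M \<and> f \<in> F}"
  interpret R: cring ?R by (rule cring)
  assume "solvable_in_seqs M n F g"
  then obtain x where x: "\<And>f. f \<in> F \<Longrightarrow> dpoly_apply M f x = zero_seq M" "dpoly_apply M g x \<noteq> zero_seq M"
    unfolding solvable_in_seqs_def by blast
  obtain e :: nat where gR: "g \<in> carrier ?R" and e: "g ^ e \<in> Idl\<^bsub>?R\<^esub> ?G"
    using g by (auto simp: in_radical_diff_ideal_def radical_def dpoly_ring_nat_pow)
  define ev where "ev j = eval_mpoly (\<lambda>a. a) (\<lambda>(i, m). seq_shift M m (x i) j)" for j
  have app: "dpoly_apply M f x = (\<lambda>j\<in>M. ev j f)" for f by (simp add: dpoly_apply_def ev_def)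
  have "ev j g = 0" if j: "j \<in> M" for j
  proof -
    let ?S = "ring_of_type_algebra :: 'k ring"
    have hom: "ring_hom_ring ?R ?S (ev j)"
      by (rule ring_hom_ringI)
        (auto simp: R.ring_axioms cring.axioms(1)[OF cring_from_type_algebra] dpoly_ring_simps
          ev_def eval_id eval_id_1, auto simp: ring_of_type_algebra_def)
    have "?G \<subseteq> a_kernel ?R ?S (ev j)"
    proof
      fix p assume "p \<in> ?G"
      then obtain m f where p: "p = dpoly_shift m f" and m: "m \<in> M" and f: "f \<in> F" by blast
      \<comment> \<open>The shifted polynomial at time \<open>j\<close> is the original one at time
        \<open>j + m\<close>.\<close>
      have "dpoly_apply M p x j = 0"
        using m j f by (simp add: p dpoly_apply_shift M_closed x(1) zero_seq_def seq_shift_def)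
      moreover have "p \<in> carrier ?R" unfolding p using f F m by (blast intro: carrier_dpoly_shift)
      ultimately show "p \<in> a_kernel ?R ?S (ev j)"
        using j by (simp add: app a_kernel_def' ring_of_type_algebra_def)
    qed
    then have "g ^ e \<in> a_kernel ?R ?S (ev j)"
      using R.genideal_minimal[OF ring_hom_ring.kernel_is_ideal[OF hom]] e by blast
    then have "ev j (g ^ e) = 0" by (simp add: a_kernel_def' ring_of_type_algebra_def)
    then show ?thesis by (simp add: ev_def eval_id_power)
  qed
  then have "dpoly_apply M g x = zero_seq M" by (auto simp: app zero_seq_def)
  with x(2) show False ..
qed

end


section \<open>The difference system of a program\<close>

definition multilinear_term :: "'k \<Rightarrow> (nat \<times> int) list \<Rightarrow> 'k \<times> ((nat \<times> int) \<times> nat) list" where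
  "multilinear_term a vs = (a, map (\<lambda>v. (v, 1)) vs)"

lemma dpoly_of_Nil: "dpoly_of [] = 0"
  by (simp add: dpoly_of_def)

lemma dpoly_of_multilinear_term: "dpoly_of (multilinear_term a vs # ts) = Const a * prod_list (map Var vs) + dpoly_of ts"
  by (simp add: dpoly_of_def multilinear_term_def o_def)

lemma multilinear_term_in: "multilinear_term a vs # ts \<in> dpoly_exprs K n M \<longleftrightarrow>
    a \<in> K \<and> set vs \<subseteq> {1..n} \<times> M \<and> ts \<in> dpoly_exprs K n M"
  by (fastforce simp: dpoly_exprs_def multilinear_term_def simp del: atLeastAtMost_iff)

text \<open>The indeterminates are: 1, a variable that is nonzero only at the starting time;
  2, an inverse that witnesses a failed equality test; \<open>r + 3\<close>, the contents of register \<open>r\<close>; and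
  \<open>\<nu> l\<close>, the indicator of control being at \<open>l\<close>. The input \<open>y\<close> is placed in register 1.\<close>

definition input_eq :: "nat \<Rightarrow> 'k::field dpoly_expr" where
  "input_eq y = [multilinear_term (of_nat y) [(1, 0)], multilinear_term (- 1) [(1, 0), (4, 0)]]"

section \<open>Equations of a control graph\<close>

text \<open>The bound \<open>N + 3\<close> keeps the indicators apart from indeterminates 1 and 2
  and from the registers, which occupy 3 to \<open>N + 3\<close>.\<close>

locale control_graph =
  fixes L :: "com list set" and \<nu> :: "com list \<Rightarrow> nat" and N :: nat
  assumes closed: "l \<in> L \<Longrightarrow> on_eq (instr l) \<in> L" "l \<in> L \<Longrightarrow> on_neq (instr l) \<in> L"
    and regs: "l \<in> L \<Longrightarrow> dst (instr l) \<le> N" "l \<in> L \<Longrightarrow> src (instr l) \<le> N"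
      "l \<in> L \<Longrightarrow> lhs (instr l) \<le> N" "l \<in> L \<Longrightarrow> rhs (instr l) \<le> N" "1 \<le> N"
    and \<nu>: "inj_on \<nu> L" "l \<in> L \<Longrightarrow> N + 3 < \<nu> l"
begin

definition start_eq :: "com list \<Rightarrow> 'k::field dpoly_expr" where
  "start_eq l = [multilinear_term 1 [(1, 0), (\<nu> l, 0)], multilinear_term (- 1) [(1, 0)]]"

definition reg_eq :: "nat \<Rightarrow> 'k::field dpoly_expr" where
  "reg_eq r = [multilinear_term 1 [(1, 0), (r + 3, 0)]]"

definition halt_eq :: "'k::field dpoly_expr" where
  "halt_eq = [multilinear_term 1 [(\<nu> [], 0)]]"

definition assign_eq :: "com list \<Rightarrow> 'k::field dpoly_expr" where
  "assign_eq l = [multilinear_term 1 [(\<nu> l, 0), (dst (instr l) + 3, 1)], multilinear_term (- 1) [(\<nu> l, 0), (src (instr l) + 3, 0)],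
     multilinear_term (- of_nat (inc (instr l))) [(\<nu> l, 0)]]"

definition keep_eq :: "com list \<Rightarrow> nat \<Rightarrow> 'k::field dpoly_expr" where
  "keep_eq l r = [multilinear_term 1 [(\<nu> l, 0), (r + 3, 1)], multilinear_term (- 1) [(\<nu> l, 0), (r + 3, 0)]]"

text \<open>At \<open>l\<close>, equal contents force the indicator of \<open>on_eq\<close> to be 1
  at the next time. For unequal contents the equation can be met with indicator 0, by taking the
  inverse of the difference for indeterminate 2.\<close>

definition goto_eq :: "com list \<Rightarrow> 'k::field dpoly_expr" where
  "goto_eq l = [multilinear_term 1 [(\<nu> l, 0), (\<nu> (on_eq (instr l)), 1)],
     multilinear_term 1 [(\<nu> l, 0), (lhs (instr l) + 3, 0), (2, 0)], multilinear_term (- 1) [(\<nu> l, 0), (rhs (instr l) + 3, 0), (2, 0)],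
     multilinear_term (- 1) [(\<nu> l, 0)]]"

text \<open>At \<open>l\<close>, the difference of the tested registers times (next indicator of
  \<open>on_neq\<close> minus 1) is 0, so unequal contents force control to
  \<open>on_neq\<close>.\<close>

definition goto_neq :: "com list \<Rightarrow> 'k::field dpoly_expr" where
  "goto_neq l = [multilinear_term 1 [(\<nu> l, 0), (lhs (instr l) + 3, 0), (\<nu> (on_neq (instr l)), 1)],
     multilinear_term (- 1) [(\<nu> l, 0), (rhs (instr l) + 3, 0), (\<nu> (on_neq (instr l)), 1)],
     multilinear_term (- 1) [(\<nu> l, 0), (lhs (instr l) + 3, 0)], multilinear_term 1 [(\<nu> l, 0), (rhs (instr l) + 3, 0)]]"

lemma dpoly_of_eqs:
  "dpoly_of (input_eq y) = Var (1, 0) * (of_nat y - Var (4, 0))"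
  "dpoly_of (start_eq l) = Var (1, 0) * (Var (\<nu> l, 0) - 1)"
  "dpoly_of (reg_eq r) = Var (1, 0) * Var (r + 3, 0)"
  "dpoly_of halt_eq = Var (\<nu> [], 0)"
  "dpoly_of (assign_eq l) = Var (\<nu> l, 0) * (Var (dst (instr l) + 3, 1) - Var (src (instr l) + 3, 0) - of_nat (inc (instr l)))"
  "dpoly_of (keep_eq l r) = Var (\<nu> l, 0) * (Var (r + 3, 1) - Var (r + 3, 0))"
  "dpoly_of (goto_eq l) = Var (\<nu> l, 0) *
     (Var (\<nu> (on_eq (instr l)), 1) + (Var (lhs (instr l) + 3, 0) - Var (rhs (instr l) + 3, 0)) * Var (2, 0) - 1)"
  "dpoly_of (goto_neq l) = Var (\<nu> l, 0) *
     ((Var (lhs (instr l) + 3, 0) - Var (rhs (instr l) + 3, 0)) * (Var (\<nu> (on_neq (instr l)), 1) - 1))"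
  unfolding input_eq_def start_eq_def reg_eq_def halt_eq_def assign_eq_def keep_eq_def goto_eq_def goto_neq_def
  by (simp_all add: dpoly_of_multilinear_term dpoly_of_Nil Const_1 Const_uminus Const_of_nat algebra_simps)

text \<open>Register 1 is left to the input equation, so the system does not depend on the input.
  The equations \<open>keep_eq\<close> say that registers other than the destination do not
  change.\<close>

definition system :: "com list \<Rightarrow> 'k::field dpoly_expr set" where
  "system l\<^sub>0 = {start_eq l\<^sub>0, halt_eq} \<union> reg_eq ` ({..N} - {1}) \<union> assign_eq ` L \<union> goto_eq ` L \<union> goto_neq ` L \<union>
     {keep_eq l r |l r. l \<in> L \<and> r \<le> N \<and> r \<noteq> dst (instr l)}"

lemma finite_system:
  assumes "finite L"
  shows "finite (system l\<^sub>0)"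
proof -
  have "{keep_eq l r |l r. l \<in> L \<and> r \<le> N \<and> r \<noteq> dst (instr l)} \<subseteq> (\<lambda>(l, r). keep_eq l r) ` (L \<times> {..N})" by auto
  then show ?thesis unfolding system_def using assms finite_subset by fastforce
qed

end

section \<open>Correctness of the difference system\<close>

locale dpoly_control_graph = dpoly_context K M + control_graph L \<nu> N
  for K :: "'k::field_char_0 set" and M L \<nu> N +
  fixes n :: nat and l\<^sub>0 :: "com list"
  assumes \<nu>_le: "l \<in> L \<Longrightarrow> \<nu> l \<le> n" and l\<^sub>0: "l\<^sub>0 \<in> L" and halt: "[] \<in> L"
begin

lemma vars: "1 \<in> {1..n}" "2 \<in> {1..n}" "r \<le> N \<Longrightarrow> r + 3 \<in> {1..n}" "l \<in> L \<Longrightarrow> \<nu> l \<in> {1..n}" "4 \<in> {1..n}"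
  using \<nu>(2)[OF l\<^sub>0] \<nu>_le[OF l\<^sub>0] \<nu>(2) \<nu>_le regs(5) by force+

lemma input_eq_in: "input_eq y \<in> dpoly_exprs K n M"
  unfolding input_eq_def using vars
  by (auto simp: multilinear_term_in M_closed K_closed K_of_nat) (simp add: dpoly_exprs_def)

lemma system_subset: "system l\<^sub>0 \<subseteq> dpoly_exprs K n M"
proof -
  have nil: "[] \<in> dpoly_exprs K n M" by (simp add: dpoly_exprs_def)
  show ?thesis
    unfolding system_def start_eq_def reg_eq_def halt_eq_def assign_eq_def keep_eq_def goto_eq_def goto_neq_def
    using vars(1,2)
    by (auto simp: multilinear_term_in nil M_closed K_closed K_of_nat l\<^sub>0 halt simp del: atLeastAtMost_iff
        intro!: vars(3,4)[unfolded One_nat_def] closed regs)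
qed

text \<open>The set \<open>J\<close> is the ideal quotient by the first indeterminate at time \<open>0\<close>. Modulo \<open>J\<close> the equations force the
  run of the machine.\<close>

lemma converges_imp_in_radical:
  fixes y :: nat
  assumes halts: "fst ((step ^^ t) (l\<^sub>0, \<lambda>r. if r = 1 then y else 0)) = []"
  shows "in_radical_diff_ideal K M n (dpoly_of ` insert (input_eq y) (system l\<^sub>0)) (Var (1, 0))"
proof -
  let ?R = "dpoly_ring K n M"
  let ?F = "dpoly_of ` insert (input_eq y) (system l\<^sub>0)"
  let ?G = "{dpoly_shift m f |m f. m \<in> M \<and> f \<in> ?F}"
  define I where "I = Idl\<^bsub>?R\<^esub> ?G"
  interpret R: cring ?R by (rule cring)
  have F: "?F \<subseteq> carrier ?R" using input_eq_in system_subset carrier_dpoly_of by blast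
  have G: "?G \<subseteq> carrier ?R" using F carrier_dpoly_shift by blast
  interpret I: ideal I ?R unfolding I_def by (rule R.genideal_ideal[OF G])
  have I_gen: "dpoly_shift m (dpoly_of e) \<in> I" if "m \<in> M" "e \<in> insert (input_eq y) (system l\<^sub>0)" for m e
    using R.genideal_self[OF G] that unfolding I_def by blast
  have I_add: "a + b \<in> I" if "a \<in> I" "b \<in> I" for a b
    using I.a_closed that by (simp add: dpoly_ring_simps)
  have I_mult: "c * a \<in> I" if "a \<in> I" "c \<in> carrier ?R" for a c
    using I.I_l_closed that by (simp add: dpoly_ring_simps)
  define J where "J = {a \<in> carrier ?R. Var (1, 0) * a \<in> I}"
  have V: "Var (1, 0) \<in> carrier ?R" by (intro carrier_Var vars M_closed)
  have J_carrier: "a \<in> carrier ?R" if "a \<in> J" for a using that by (simp add: J_def)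
  have J_add: "a + b \<in> J" if "a \<in> J" "b \<in> J" for a b
    using that by (simp add: J_def carrier_add distrib_left I_add)
  have J_mult: "c * a \<in> J" if "a \<in> J" "c \<in> carrier ?R" for a c
    using that I_mult[of "Var (1, 0) * a" c] by (simp add: J_def carrier_mult mult.left_commute)
  have J_diff: "a - b \<in> J" if "a \<in> J" "b \<in> J" for a b
    using J_add[OF that(1) J_mult[OF that(2), of "- 1"]] by (simp add: carrier_uminus carrier_1)
  have IJ: "a \<in> J" if "a \<in> I" for a
    using that I_mult[OF that V] I.a_subset by (auto simp: J_def)
  have cancel: "a \<in> J" if "b * a \<in> J" "b - 1 \<in> J" "a \<in> carrier ?R" for a b
    using J_diff[OF that(1) J_mult[OF that(2,3)]] by (simp add: algebra_simps)
  have Vars: "r \<le> N \<Longrightarrow> Var (r + 3, int m) \<in> carrier ?R" "l \<in> L \<Longrightarrow> Var (\<nu> l, int m) \<in> carrier ?R"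
    "Var (2, int m) \<in> carrier ?R" for r l m
    by (auto intro!: carrier_Var vars M_closed simp del: atLeastAtMost_iff)
  have nat_in: "of_nat i \<in> carrier ?R" for i
    using carrier_Const[OF K_of_nat, of i] by (simp add: Const_of_nat)
  have gen: "dpoly_shift (int m) (dpoly_of e) \<in> J" if "e \<in> system l\<^sub>0" for m e
    using IJ[OF I_gen] M_closed that by blast
  \<comment> \<open>Modulo \<open>J\<close>, at time \<open>m\<close> the current indicator is 1 and
    every register indeterminate is the actual contents in the run.\<close>
  have run: "fst c \<in> L \<and> Var (\<nu> (fst c), int m) - 1 \<in> J \<and>
      (\<forall>r\<le>N. Var (r + 3, int m) - of_nat (snd c r) \<in> J)"
    if "c = (step ^^ m) (l\<^sub>0, \<lambda>r. if r = 1 then y else 0)" for m c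
    using that
  proof (induction m arbitrary: c)
    case 0
    \<comment> \<open>The initial equations carry the first indeterminate at time 0 as a factor, so
      by definition of the quotient their cofactors lie in \<open>J\<close>.\<close>
    have init: "a \<in> J" if "e \<in> insert (input_eq y) (system l\<^sub>0)" "dpoly_shift 0 (dpoly_of e) = Var (1, 0) * a" "a \<in> carrier ?R"
      for e a
      using I_gen[OF M_closed(1) that(1)] that(2,3) by (simp add: J_def)
    have "Var (\<nu> l\<^sub>0, 0) - 1 \<in> J"
      by (rule init[of "start_eq l\<^sub>0"])
        (use Vars(2)[OF l\<^sub>0, of 0] in \<open>auto simp: system_def dpoly_of_eqs dpoly_shift_simps carrier_diff carrier_1\<close>)
    moreover have "Var (r + 3, 0) - of_nat (if r = 1 then y else 0) \<in> J" if "r \<le> N" for r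
    proof (cases "r = 1")
      case True
      have "of_nat y - Var (4, 0) \<in> J"
        by (rule init[of "input_eq y"])
          (use Vars(1)[OF regs(5), of 0] in \<open>auto simp: dpoly_of_eqs dpoly_shift_simps carrier_diff nat_in\<close>)
      then have "- 1 * (of_nat y - Var (4, 0)) \<in> J" by (rule J_mult) (simp add: carrier_uminus carrier_1)
      then show ?thesis using True by simp
    next
      case False
      have "Var (r + 3, 0) \<in> J"
        by (rule init[of "reg_eq r"])
          (use Vars(1)[OF that, of 0] that False in \<open>auto simp: system_def dpoly_of_eqs dpoly_shift_simps\<close>)
      then show ?thesis using False by simp
    qed
    ultimately show ?case using 0 l\<^sub>0 by simp
  next
    case (Suc m)
    define c' where "c' = (step ^^ m) (l\<^sub>0, \<lambda>r. if r = 1 then y else 0)"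
    obtain l s where c': "c' = (l, s)" by fastforce
    have l: "l \<in> L" and Y: "Var (\<nu> l, int m) - 1 \<in> J"
      and s: "\<And>r. r \<le> N \<Longrightarrow> Var (r + 3, int m) - of_nat (s r) \<in> J"
      using Suc.IH[OF c'_def] by (simp_all add: c')
    have c: "c = step (l, s)" using Suc.prems c' unfolding c'_def by (simp del: step.simps)
    have eqJ: "a \<in> J" if "e \<in> system l\<^sub>0" "dpoly_shift (int m) (dpoly_of e) = Var (\<nu> l, int m) * a" "a \<in> carrier ?R"
      for e a
      using gen[OF that(1), of m] cancel[OF _ Y] that(2,3) by simp
    have Suc_m: "int m + 1 = int (Suc m)" by simp
    have reg: "Var (r + 3, int (Suc m)) - of_nat (snd c r) \<in> J" if r: "r \<le> N" for r
    proof (cases "r = dst (instr l)")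
      case True
      have "Var (r + 3, int (Suc m)) - Var (src (instr l) + 3, int m) - of_nat (inc (instr l)) \<in> J"
        by (rule eqJ[of "assign_eq l"])
          (use l True Vars(1)[OF regs(2)[OF l], of m] Vars(1)[OF r, of "Suc m"] in
            \<open>auto simp: system_def dpoly_of_eqs dpoly_shift_simps carrier_diff nat_in add.commute\<close>)
      from J_add[OF this s[OF regs(2)[OF l]]] show ?thesis
        using True by (simp add: c algebra_simps)
    next
      case False
      have "Var (r + 3, int (Suc m)) - Var (r + 3, int m) \<in> J"
        by (rule eqJ[of "keep_eq l r"])
          (use l r False Vars(1)[OF r, of m] Vars(1)[OF r, of "Suc m"] in
            \<open>auto simp: system_def dpoly_of_eqs dpoly_shift_simps carrier_diff add.commute\<close>)
      from J_add[OF this s[OF r]] show ?thesis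
        using False by (simp add: c algebra_simps)
    qed
    let ?i = "lhs (instr l)" and ?j = "rhs (instr l)"
    let ?X = "\<lambda>r. Var (r + 3, int m) :: 'k dpoly"
    have test: "(?X ?i - ?X ?j) - (of_nat (s ?i) - of_nat (s ?j)) \<in> J"
      using J_diff[OF s[OF regs(3)[OF l]] s[OF regs(4)[OF l]]] by (simp add: algebra_simps)
    have Xs: "?X ?i \<in> carrier ?R" "?X ?j \<in> carrier ?R" by (intro Vars regs l)+
    have "fst c \<in> L \<and> Var (\<nu> (fst c), int (Suc m)) - 1 \<in> J"
    proof (cases "s ?i = s ?j")
      case True
      let ?Z = "Var (\<nu> (on_eq (instr l)), int (Suc m)) :: 'k dpoly"
      have "?Z + (?X ?i - ?X ?j) * Var (2, int m) - 1 \<in> J"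
        by (rule eqJ[of "goto_eq l"])
          (use l Xs Vars(2)[OF closed(1)[OF l], of "Suc m"] Vars(3) in
            \<open>auto simp: system_def dpoly_of_eqs dpoly_shift_simps carrier_diff carrier_add carrier_mult carrier_1 add.commute\<close>)
      \<comment> \<open>Since the contents agree, the difference of the tested registers lies in
        \<open>J\<close> and the term with the auxiliary inverse disappears.\<close>
      moreover have "Var (2, int m) * (?X ?i - ?X ?j) \<in> J"
        using test True by (intro J_mult Vars) simp
      ultimately have "?Z + (?X ?i - ?X ?j) * Var (2, int m) - 1 - Var (2, int m) * (?X ?i - ?X ?j) \<in> J"
        by (rule J_diff)
      then have "?Z - 1 \<in> J" by (simp add: algebra_simps)
      then show ?thesis using True closed(1)[OF l] by (simp add: c)
    next
      case False
      let ?Z = "Var (\<nu> (on_neq (instr l)), int (Suc m)) :: 'k dpoly"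
      have Z: "?Z - 1 \<in> carrier ?R" by (intro carrier_diff carrier_1 Vars closed l)
      define d :: 'k where "d = of_nat (s ?i) - of_nat (s ?j)"
      have d: "Const d = of_nat (s ?i) - (of_nat (s ?j) :: 'k dpoly)"
        by (simp add: d_def Const_diff Const_of_nat)
      \<comment> \<open>Characteristic zero keeps distinct contents distinct in the field, so
        \<open>d\<close> is a unit that can be cancelled.\<close>
      have "d \<noteq> 0" using False by (simp add: d_def)
      have "d \<in> K" unfolding d_def using K_closed(3)[OF K_of_nat K_closed(4)[OF K_of_nat]] by simp
      then have inv: "Const (inverse d) \<in> carrier ?R" using \<open>d \<noteq> 0\<close> by (intro carrier_Const K_closed)
      have "(?X ?i - ?X ?j) * (?Z - 1) \<in> J"
        by (rule eqJ[of "goto_neq l"])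
          (use l Xs Z in
            \<open>auto simp: system_def dpoly_of_eqs dpoly_shift_simps carrier_diff carrier_mult add.commute\<close>)
      moreover have "(?Z - 1) * ((?X ?i - ?X ?j) - Const d) \<in> J"
        using test Z unfolding d by (intro J_mult)
      ultimately have "(?X ?i - ?X ?j) * (?Z - 1) - (?Z - 1) * ((?X ?i - ?X ?j) - Const d) \<in> J"
        by (rule J_diff)
      then have "Const d * (?Z - 1) \<in> J" by (simp add: algebra_simps)
      then have "Const (inverse d) * (Const d * (?Z - 1)) \<in> J" using inv by (rule J_mult)
      moreover have "Const (inverse d) * (Const d * (?Z - 1)) = ?Z - 1"
        using \<open>d \<noteq> 0\<close> by (simp add: mult.assoc[symmetric] Const_mult[symmetric] Const_1)
      ultimately show ?thesis using False closed(2)[OF l] by (simp add: c)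
    qed
    with reg show ?case by blast
  qed
  \<comment> \<open>At the halting time the final indicator is 1 modulo \<open>J\<close> by the run
    and 0 modulo \<open>J\<close> by \<open>halt_eq\<close>.\<close>
  have "Var (\<nu> [], int t) - 1 \<in> J" using run[OF refl, of t] halts by simp
  moreover have "Var (\<nu> [], int t) \<in> J"
    using gen[of halt_eq t] by (simp add: system_def dpoly_of_eqs dpoly_shift_simps)
  ultimately have "1 \<in> J" using J_diff by fastforce
  then have "Var (1, 0) \<in> I" by (simp add: J_def)
  then show ?thesis
    unfolding in_radical_diff_ideal_def radical_def I_def[symmetric]
    using V by (auto simp: dpoly_ring_nat_pow intro!: exI[of _ "1::nat"])
qed

text \<open>The infinite run is the solution, with zeros at negative times. Every equation is a
  multiple of an indicator or of the first indeterminate at the present time, so the jump from time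
  -1 to time 0 violates none.\<close>

lemma diverges_imp_solvable:
  fixes y :: nat
  assumes div: "diverges (l\<^sub>0, \<lambda>r. if r = 1 then y else 0)"
  shows "solvable_in_seqs M n (dpoly_of ` insert (input_eq y) (system l\<^sub>0)) (Var (1, 0) :: 'k dpoly)"
proof -
  define cf where "cf t = (step ^^ t) (l\<^sub>0, \<lambda>r. if r = 1 then y else 0)" for t
  define l where "l t = fst (cf t)" for t
  define s where "s t = snd (cf t)" for t
  have init: "l 0 = l\<^sub>0" "s 0 = (\<lambda>r. if r = 1 then y else 0)"
    by (simp_all add: l_def s_def cf_def)
  have cf_Suc: "cf (Suc t) = step (l t, s t)" for t
    by (simp add: cf_def l_def s_def del: step.simps)
  have l_Suc: "l (Suc t) = (if s t (lhs (instr (l t))) = s t (rhs (instr (l t)))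
      then on_eq (instr (l t)) else on_neq (instr (l t)))" for t
    using cf_Suc[of t] by (simp add: l_def)
  have s_Suc: "s (Suc t) = (s t)(dst (instr (l t)) := s t (src (instr (l t))) + inc (instr (l t)))" for t
    using cf_Suc[of t] by (simp add: s_def)
  have l_in: "l t \<in> L" for t
    by (induction t) (simp_all add: init l\<^sub>0 l_Suc closed)
  have l_ne: "l t \<noteq> []" for t using div by (simp add: diverges_def l_def cf_def)
  \<comment> \<open>Comparing the next control point with \<open>on_eq\<close>, and not the
    contents, gives the right value even if both branches have the same target. When the control
    points differ the test has failed, so \<open>d\<close> is nonzero.\<close>
  define w where "w t = (let d = of_nat (s t (lhs (instr (l t)))) - of_nat (s t (rhs (instr (l t)))) :: 'k
      in (if l (Suc t) = on_eq (instr (l t)) then 0 else inverse d))" for t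
  define val :: "nat \<Rightarrow> int \<Rightarrow> 'k" where "val i j = (if j < 0 then 0
      else if i = 1 then of_bool (j = 0) else if i = 2 then w (nat j)
      else if i \<le> N + 3 then of_nat (s (nat j) (i - 3)) else of_bool (i = \<nu> (l (nat j))))" for i j
  define x where "x = (\<lambda>i\<in>{1..n}. \<lambda>j\<in>M. val i j)"
  define ev where "ev j = eval_mpoly (\<lambda>a. a) (\<lambda>(i, m). seq_shift M m (x i) j)" for j
  have ev: "ev j (p + q) = ev j p + ev j q" "ev j (p - q) = ev j p - ev j q" "ev j (p * q) = ev j p * ev j q"
    "ev j 1 = 1" "ev j (of_nat k) = of_nat k" for j p q k
    unfolding ev_def using eval_mpoly_Const[of "\<lambda>a. a" _ "of_nat k"]
    by (simp_all add: eval_id eval_id_1 Const_of_nat)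
  have ev_Var: "ev j (Var (i, m)) = val i (j + m)" if "j \<in> M" "m \<in> M" "i \<in> {1..n}" for i j m
    using that M_closed(4) by (simp add: ev_def eval_id seq_shift_def x_def)
  have val_reg: "val (r + 3) j = (if j < 0 then 0 else of_nat (s (nat j) r))" if "r \<le> N" for r j
    using that by (simp add: val_def)
  \<comment> \<open>The run stays in \<open>L\<close>, where \<nu> is injective, so exactly the
    indicator of the current control point is 1.\<close>
  have val_loc: "val (\<nu> k) j = of_bool (0 \<le> j \<and> l (nat j) = k)" if "k \<in> L" for k j
    using \<nu>(2)[OF that] inj_on_eq_iff[OF \<nu>(1) that l_in[of "nat j"]] regs(5) by (auto simp: val_def)
  have val_1: "val 1 j = of_bool (j = 0)" for j by (simp add: val_def)
  have val_2: "val 2 j = (if j < 0 then 0 else w (nat j))" for j by (simp add: val_def)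
  note ev_vars = ev_Var[OF _ M_closed(1)] ev_Var[OF _ M_closed(2)]
  have zero: "ev j (dpoly_of e) = 0" if j: "j \<in> M" and e: "e \<in> insert (input_eq y) (system l\<^sub>0)" for e j
  proof -
    have regs_0: "ev j (Var (r + 3, 0)) = (if j < 0 then 0 else of_nat (s (nat j) r))" if "r \<le> N" for r
      using ev_vars(1)[OF j vars(3)[OF that]] val_reg[OF that] by simp
    have regs_1: "ev j (Var (r + 3, 1)) = of_nat (s (Suc (nat j)) r)" if "r \<le> N" "0 \<le> j" for r
      using ev_vars(2)[OF j vars(3)[OF that(1)]] val_reg[OF that(1)] that(2) by (simp add: nat_add_distrib)
    have loc_0: "ev j (Var (\<nu> k, 0)) = of_bool (0 \<le> j \<and> l (nat j) = k)" if "k \<in> L" for k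
      using ev_vars(1)[OF j vars(4)[OF that]] val_loc[OF that] by simp
    have loc_1: "ev j (Var (\<nu> k, 1)) = of_bool (l (Suc (nat j)) = k)" if "k \<in> L" "0 \<le> j" for k
      using ev_vars(2)[OF j vars(4)[OF that(1)]] val_loc[OF that(1)] that(2) by (simp add: nat_add_distrib)
    have v: "ev j (Var (1, 0)) = of_bool (j = 0)" using ev_vars(1)[OF j vars(1)] val_1 by simp
    have w: "ev j (Var (2, 0)) = w (nat j)" if "0 \<le> j" using ev_vars(1)[OF j vars(2)] val_2 that by simp
    consider "e = input_eq y" | "e = start_eq l\<^sub>0" | "e = halt_eq"
      | r where "e = reg_eq r" "r \<le> N" "r \<noteq> 1"
      | k where "e = assign_eq k" "k \<in> L" | k where "e = goto_eq k" "k \<in> L" | k where "e = goto_neq k" "k \<in> L"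
      | k r where "e = keep_eq k r" "k \<in> L" "r \<le> N" "r \<noteq> dst (instr k)"
      using e unfolding system_def by blast
    then show ?thesis
    proof cases
      case 1
      have "ev j (Var (4, 0)) = (if j < 0 then 0 else of_nat (s (nat j) 1))" using regs_0[OF regs(5)] by simp
      then show ?thesis by (simp add: 1 dpoly_of_eqs ev v[simplified] init)
    next
      case 2
      then show ?thesis by (simp add: dpoly_of_eqs ev v[simplified] init loc_0 l\<^sub>0)
    next
      case 3
      then show ?thesis by (simp add: dpoly_of_eqs loc_0 halt l_ne)
    next
      case 4
      then show ?thesis by (simp add: dpoly_of_eqs ev v[simplified] init regs_0)
    next
      case (5 k)
      then show ?thesis
        by (cases "0 \<le> j \<and> l (nat j) = k")
          (auto simp: dpoly_of_eqs ev regs_0 regs_1 loc_0 regs s_Suc)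
    next
      case (6 k)
      show ?thesis
      proof (cases "0 \<le> j \<and> l (nat j) = k")
        case True
        \<comment> \<open>Either the indicator is 1 and \<open>w\<close> is 0, or the indicator is 0
          and \<open>w\<close> inverts the nonzero difference.\<close>
        have "ev j (Var (\<nu> (on_eq (instr k)), 1)) + (of_nat (s (nat j) (lhs (instr k))) - of_nat (s (nat j) (rhs (instr k)))) * w (nat j) = 1"
          using True loc_1[OF closed(1)[OF 6(2)]] l_Suc[of "nat j"] by (auto simp: w_def Let_def)
        then show ?thesis using 6 True by (simp add: dpoly_of_eqs ev regs_0 loc_0 regs w)
      next
        case False
        then show ?thesis using 6 by (simp add: dpoly_of_eqs ev loc_0)
      qed
    next
      case (7 k)
      show ?thesis
      proof (cases "0 \<le> j \<and> l (nat j) = k")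
        case True
        then show ?thesis
          using 7 loc_1[OF closed(2)[OF 7(2)]] l_Suc[of "nat j"]
          by (auto simp: dpoly_of_eqs ev regs_0 loc_0 regs)
      next
        case False
        then show ?thesis using 7 by (simp add: dpoly_of_eqs ev loc_0)
      qed
    next
      case (8 k r)
      then show ?thesis
        by (cases "0 \<le> j \<and> l (nat j) = k")
          (auto simp: dpoly_of_eqs ev regs_0 regs_1 loc_0 s_Suc)
    qed
  qed
  have app: "dpoly_apply M f x = (\<lambda>j\<in>M. ev j f)" for f by (simp add: dpoly_apply_def ev_def)
  have "dpoly_apply M f x = zero_seq M" if "f \<in> dpoly_of ` insert (input_eq y) (system l\<^sub>0)" for f
    unfolding app zero_seq_def using zero that by (intro restrict_ext) blast
  moreover have "dpoly_apply M (Var (1, 0)) x 0 \<noteq> zero_seq M 0"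
    using M_closed(1) ev_vars(1)[OF M_closed(1) vars(1)] val_1 by (simp add: app zero_seq_def)
  then have "dpoly_apply M (Var (1, 0)) x \<noteq> zero_seq M" by metis
  moreover have "x \<in> {1..n} \<rightarrow>\<^sub>E (M \<rightarrow>\<^sub>E UNIV)" by (auto simp: x_def)
  ultimately show ?thesis unfolding solvable_in_seqs_def by (intro bexI[of _ x] conjI ballI)
qed

end

section \<open>The reduction and undecidability\<close>

text \<open>\<open>S\<close> and \<open>N\<close> depend on \<open>q\<close> alone, and
  \<open>n\<close> may be any larger number. The diagonal argument relies on both: its input is a
  code of \<open>S\<close> and also fixes the number of indeterminates.\<close>

lemma (in dpoly_context) ex_system:
  "\<exists>S N. finite S \<and> S \<noteq> {} \<and> (\<forall>n y. N \<le> n \<longrightarrow> insert (input_eq y) S \<subseteq> dpoly_exprs K n M \<and>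
     ((\<exists>z. computes q [y] z) \<longrightarrow>
        in_radical_diff_ideal K M n (dpoly_of ` insert (input_eq y) S) (Var (1, 0))) \<and>
     ((\<nexists>z. computes q [y] z) \<longrightarrow>
        solvable_in_seqs M n (dpoly_of ` insert (input_eq y) S) (Var (1, 0))))"
proof -
  obtain c where halts: "\<And>y z. computes q [y] z \<Longrightarrow> \<exists>n. fst ((step ^^ n) ([c], \<lambda>r. if r = 1 then y else 0)) = []"
    and div: "\<And>y. \<nexists>z. computes q [y] z \<Longrightarrow> diverges ([c], \<lambda>r. if r = 1 then y else 0)"
    using ex_com[of q] by metis
  define L where "L = insert [] (locs c [])"
  have fin: "finite L" by (simp add: L_def finite_locs)
  have closed: "on_eq (instr l) \<in> L" "on_neq (instr l) \<in> L" if "l \<in> L" for l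
    using that locs_closed[of l c "[]"] by (auto simp: L_def)
  define regs where "regs = insert 1 (\<Union>l\<in>L. {dst (instr l), src (instr l), lhs (instr l), rhs (instr l)})"
  have "finite regs" using fin by (simp add: regs_def)
  then obtain N where N: "\<And>r. r \<in> regs \<Longrightarrow> r \<le> N" by (meson finite_nat_set_iff_bounded_le)
  obtain f :: "com list \<Rightarrow> nat" where f: "inj_on f L"
    using finite_imp_inj_to_nat_seg[OF fin] by blast
  define \<nu> where "\<nu> l = f l + N + 4" for l
  have "finite (\<nu> ` L)" using fin by simp
  then obtain B where B: "\<And>l. l \<in> L \<Longrightarrow> \<nu> l \<le> B"
    by (metis finite_nat_set_iff_bounded_le imageI)
  have graph: "control_graph L \<nu> N"
  proof
    show "inj_on \<nu> L" using f by (auto simp: \<nu>_def inj_on_def)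
  qed (auto intro!: N closed simp: regs_def \<nu>_def)
  have ctx: "dpoly_control_graph K M L \<nu> N n [c]" if "B \<le> n" for n
    by (intro dpoly_control_graph.intro dpoly_context_axioms graph dpoly_control_graph_axioms.intro)
      (use B that start_in_locs[of c "[]"] in \<open>auto simp: L_def intro: order_trans\<close>)
  show ?thesis
  proof (rule exI[of _ "control_graph.system L \<nu> N [c]"], rule exI[of _ B], intro conjI allI impI)
    show "finite (control_graph.system L \<nu> N [c])" by (rule control_graph.finite_system[OF graph fin])
    show "control_graph.system L \<nu> N [c] \<noteq> {}" using control_graph.system_def[OF graph] by blast
    fix n y assume n: "B \<le> n"
    note ctx = ctx[OF n]
    show "insert (input_eq y) (control_graph.system L \<nu> N [c]) \<subseteq> dpoly_exprs K n M"
      using dpoly_control_graph.input_eq_in[OF ctx] dpoly_control_graph.system_subset[OF ctx] by blast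
    show "in_radical_diff_ideal K M n (dpoly_of ` insert (input_eq y) (control_graph.system L \<nu> N [c])) (Var (1, 0) :: 'k dpoly)"
      if "\<exists>z. computes q [y] z"
    proof -
      from that halts obtain t where "fst ((step ^^ t) ([c], \<lambda>r. if r = 1 then y else 0)) = []" by blast
      then show ?thesis by (rule dpoly_control_graph.converges_imp_in_radical[OF ctx])
    qed
    show "solvable_in_seqs M n (dpoly_of ` insert (input_eq y) (control_graph.system L \<nu> N [c])) (Var (1, 0) :: 'k dpoly)"
      if "\<nexists>z. computes q [y] z"
      using dpoly_control_graph.diverges_imp_solvable[OF ctx div[OF that]] .
  qed
qed

text \<open>Allows the code of a list of equations to be made as large as desired by repeating an
  equation.\<close>

lemma length_le_list_encode: "length xs \<le> list_encode xs"
proof (induction xs)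
  case (Cons x xs)
  then show ?case using le_prod_encode_2[of "list_encode xs" x] by simp
qed simp

theorem corollary3p8:
  fixes M :: "int set"
    and k\<^sub>0 :: "'k::field_char_0 set"
    and code :: "'k \<Rightarrow> nat"
  assumes "M = \<nat> \<or> M = \<int>"
    and "subfield k\<^sub>0 (ring_of_type_algebra :: 'k ring)"
    and "computable_presentation k\<^sub>0 code"
  shows "\<not> decidable (encode_system code) (systems k\<^sub>0 M)
           (\<lambda>(n, fs, g). solvable_in_seqs M n (dpoly_of ` set fs) (dpoly_of g)) \<and>
         \<not> decidable (encode_system code) (systems k\<^sub>0 M)
           (\<lambda>(n, fs, g). in_radical_diff_ideal k\<^sub>0 M n (dpoly_of ` set fs) (dpoly_of g))"
proof -
  interpret dpoly_context k\<^sub>0 M using assms(1,2) by (rule dpoly_context.intro)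
  define v :: "'k dpoly_expr" where "v = [multilinear_term 1 [(1, 0)]]"
  have v: "dpoly_of v = Var (1, 0)" by (simp add: v_def dpoly_of_multilinear_term dpoly_of_Nil Const_1)
  \<comment> \<open>This is the code of the instance with \<open>Suc y\<close> indeterminates whose
    equations are \<open>input_eq y\<close> followed by the list coded by \<open>y\<close>; a
    nonempty list is coded by the successor of the pair of head and coded tail.\<close>
  define h where "h y = prod_encode (Suc y, prod_encode (Suc (prod_encode (encode_expr code (input_eq y), y)),
      encode_expr code v))" for y
  have "total_computable (\<lambda>y. code (of_nat y))"
    using assms(3) K_of_nat by (rule total_computable_code_of_nat)
  then have h: "total_computable h"
    \<comment> \<open>Unfolded, \<open>h\<close> is built from pairings, successors, constants,
      \<open>y\<close> and the code of \<open>of_nat y\<close>.\<close>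
    unfolding h_def input_eq_def encode_expr_def multilinear_term_def list.map list_encode.simps prod.case
    by (intro total_computable_prod_encode total_computable_Suc total_computable_const total_computable_id)
  let ?solvable = "\<lambda>(n, fs, g). solvable_in_seqs M n (dpoly_of ` set fs) (dpoly_of g)"
  let ?radical = "\<lambda>(n, fs, g). in_radical_diff_ideal k\<^sub>0 M n (dpoly_of ` set fs) (dpoly_of g)"
  \<comment> \<open>One instance serves both problems, since for it membership and solvability are
    complementary.\<close>
  have red: "\<exists>y. \<exists>i\<in>systems k\<^sub>0 M. encode_system code i = h y \<and> (?radical i \<longleftrightarrow> (\<exists>z. computes q [y] z)) \<and>
      (\<not> ?solvable i \<longleftrightarrow> (\<exists>z. computes q [y] z))" for q
  proof -
    obtain S :: "'k dpoly_expr set" and N where "finite S" "S \<noteq> {}" and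
      S: "\<And>n y. N \<le> n \<Longrightarrow> insert (input_eq y) S \<subseteq> dpoly_exprs k\<^sub>0 n M"
      "\<And>n y z. N \<le> n \<Longrightarrow> computes q [y] z \<Longrightarrow>
        in_radical_diff_ideal k\<^sub>0 M n (dpoly_of ` insert (input_eq y) S) (Var (1, 0))"
      "\<And>n y. N \<le> n \<Longrightarrow> \<nexists>z. computes q [y] z \<Longrightarrow>
        solvable_in_seqs M n (dpoly_of ` insert (input_eq y) S) (Var (1, 0))"
      using ex_system[of q] by metis
    obtain e fs' where e: "e \<in> S" and fs': "set fs' = S"
      using \<open>finite S\<close> \<open>S \<noteq> {}\<close> finite_list by blast
    \<comment> \<open>The \<open>N\<close> copies of \<open>e\<close> make the code \<open>y\<close>
      at least \<open>N\<close>, so that \<open>Suc y\<close> indeterminates suffice, and leave the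
      set of equations unchanged.\<close>
    define fs where "fs = replicate N e @ fs'"
    have fs: "set fs = S" using e fs' by (auto simp: fs_def)
    \<comment> \<open>Self-reference: the input is the code of the very equations that simulate
      \<open>q\<close>.\<close>
    define y where "y = list_encode (map (encode_expr code) fs)"
    define i where "i = (Suc y, input_eq y # fs, v)"
    have N: "N \<le> Suc y"
      using length_le_list_encode[of "map (encode_expr code) fs"] by (simp add: y_def fs_def)
    have v_in: "v \<in> dpoly_exprs k\<^sub>0 (Suc y) M"
      by (auto simp: v_def multilinear_term_in K_closed M_closed) (simp add: dpoly_exprs_def)
    have "i \<in> systems k\<^sub>0 M"
      using S(1)[OF N, of y] fs v_in by (auto simp: i_def systems_def dpoly_exprs_def)
    moreover have "encode_system code i = h y"
      by (simp add: encode_system_def i_def h_def y_def)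
    moreover have "dpoly_of ` insert (input_eq y) S \<subseteq> carrier (dpoly_ring k\<^sub>0 (Suc y) M)"
      using S(1)[OF N] carrier_dpoly_of by blast
    \<comment> \<open>Convergence gives membership and divergence gives solvability; as the two
      exclude each other, both implications are equivalences.\<close>
    then have "?radical i \<longleftrightarrow> (\<exists>z. computes q [y] z)" "\<not> ?solvable i \<longleftrightarrow> (\<exists>z. computes q [y] z)"
      using in_radical_imp_not_solvable S(2,3)[OF N] unfolding i_def prod.case list.set fs v by blast+
    ultimately show ?thesis by blast
  qed
  have "\<not> decidable (encode_system code) (systems k\<^sub>0 M) ?radical"
    using h by (rule undecidable_by_diagonalization) (use red in blast)
  moreover have "\<not> decidable (encode_system code) (systems k\<^sub>0 M) (\<lambda>i. \<not> ?solvable i)"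
    using h by (rule undecidable_by_diagonalization) (use red in blast)
  ultimately show ?thesis using decidable_not by blast
qed

end
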